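(* Let $p>1$ and let $f,g,\rho,d$ satisfy the standing assumptions. Assume that the limit $\ell_0:=\lim_{u\to0^+}\rho(u)\left(\frac{d(u)}{u}\right)^{\frac1{p-1}}$ exists and $\ell_0<+\infty$, and let $c^*$ be the threshold speed. Let $u$ be a traveling wave solution with some speed $c\ge c^*$, defined in the interval $(\alpha,\beta)$. Then: - if $\liminf_{u\to0^+}d(u)>0$, then $\lim_{t\to\beta^-}u'(t)=0$, whatever $c\ge c^*$ may be; - if $d(0^+)=0$ and $\dot d(0)=+\infty$, then $\lim_{t\to\beta^-}u'(t)=0$, whatever $c\ge c^*$ may be; - if $d(0^+)=0$ and $0<\dot d(0)<+\infty$, then $$\lim_{t\to\beta^-}u'(t)=\begin{cases}-\left(\frac{c^*g(0)-f(0)}{\dot d(0)}\right)^{\frac1{p-1}}&\text{if }c=c^*\\ 0&\text{if }c>c^*;\end{cases}$$ - if $d(0^+)=0$, $\lim_{u\to0^+}\dot d(u)=0$ and $cg(0)-f(0)\neq0$, then $$\lim_{t\to\beta^-}u'(t)=\begin{cases}-\infty&\text{if }c=c^*\\0&\text{if }c>c^*.\end{cases}$$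
   Context: Standing assumptions: $p>1$; $f,g,\rho\in C[0,1]$; $d\in C^1(0,1)$; $\rho(u)>0$ in $(0,1)$ and $\rho(0)=\rho(1)=0$; $g(0)>0$ and $\int_0^u g(s)\,ds>0$ for every $u\in(0,1]$; $d(u)>0$ in $(0,1)$ and $\rho\, d^{\frac1{p-1}}\in L^1(0,1)$. A traveling wave solution (t.w.s.) with speed $c\in\mathbb R$ is a function $u\in C^1(\alpha,\beta)$, with $-\infty\le\alpha<\beta\le+\infty$, such that $0<u(t)<1$ for all $t\in(\alpha,\beta)$, $d(u)|u'|^{p-2}u'\in C^1(\alpha,\beta)$, $$(d(u)|u'|^{p-2}u')'+(cg(u)-f(u))u'+\rho(u)=0\quad\text{in }(\alpha,\beta),$$ $u(\alpha^+)=1$, $u(\beta^-)=0$, and $\lim_{t\to\alpha^+}d(u)|u'|^{p-2}u'=\lim_{t\to\beta^-}d(u)|u'|^{p-2}u'=0$. When $\ell_0$ exists and is finite, there is a threshold $c^*\in\mathbb R$ such that a t.w.s. with speed $c$ exists if and only if $c\ge c^*$. Notation: $d(0^+)=\lim_{u\to0^+}d(u)$; $\dot d(u)$ is the derivative of $d$ at $u\in(0,1)$; $\dot d(0):=\lim_{u\to0^+}\frac{d(u)}{u}$, possibly infinite (a hypothesis on $\dot d(0)$ includes that this limit exists). *)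

theory Defs
  imports "HOL-Analysis.Analysis"
begin

definition standing_assumptions ::
  "real \<Rightarrow> (real \<Rightarrow> real) \<Rightarrow> (real \<Rightarrow> real) \<Rightarrow> (real \<Rightarrow> real) \<Rightarrow> (real \<Rightarrow> real) \<Rightarrow> bool" where
  "standing_assumptions p f g \<rho> d \<longleftrightarrow>
     1 < p \<and>
     continuous_on {0..1} f \<and> continuous_on {0..1} g \<and> continuous_on {0..1} \<rho> \<and>
     d C1_differentiable_on {0<..<1} \<and>
     (\<forall>v\<in>{0<..<1}. 0 < \<rho> v) \<and> \<rho> 0 = 0 \<and> \<rho> 1 = 0 \<and>
     0 < g 0 \<and> (\<forall>v\<in>{0<..1}. 0 < integral {0..v} g) \<and>
     (\<forall>v\<in>{0<..<1}. 0 < d v) \<and>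
     set_integrable lborel {0<..<1} (\<lambda>v. \<rho> v * d v powr (1 / (p - 1)))"

text \<open>
  The flux \<open>d(u) |u'|\<^sup>p\<^sup>-\<^sup>2 u'\<close>. Where \<open>u' = 0\<close> the expression evaluates to \<open>0\<close>, its continuous
  extension for \<open>p > 1\<close>, also when \<open>p < 2\<close>.
\<close>

definition flux :: "real \<Rightarrow> (real \<Rightarrow> real) \<Rightarrow> (real \<Rightarrow> real) \<Rightarrow> real \<Rightarrow> real" where
  "flux p d u t = d (u t) * \<bar>deriv u t\<bar> powr (p - 2) * deriv u t"

text \<open>
  The endpoints are extended reals. One-sided limits at a possibly infinite endpoint are taken
  along \<open>at_right \<alpha>\<close> and \<open>at_left \<beta>\<close> in \<^typ>\<open>ereal\<close>, as in the library's interval integrals.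
\<close>

definition travelling_wave ::
  "real \<Rightarrow> (real \<Rightarrow> real) \<Rightarrow> (real \<Rightarrow> real) \<Rightarrow> (real \<Rightarrow> real) \<Rightarrow> (real \<Rightarrow> real) \<Rightarrow> real \<Rightarrow>
   ereal \<Rightarrow> ereal \<Rightarrow> (real \<Rightarrow> real) \<Rightarrow> bool" where
  "travelling_wave p f g \<rho> d c \<alpha> \<beta> u \<longleftrightarrow>
     \<alpha> < \<beta> \<and>
     u C1_differentiable_on einterval \<alpha> \<beta> \<and>
     (\<forall>t\<in>einterval \<alpha> \<beta>. 0 < u t \<and> u t < 1) \<and>
     flux p d u C1_differentiable_on einterval \<alpha> \<beta> \<and>
     (\<forall>t\<in>einterval \<alpha> \<beta>.
        deriv (flux p d u) t + (c * g (u t) - f (u t)) * deriv u t + \<rho> (u t) = 0) \<and>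
     ((u \<circ> real_of_ereal) \<longlongrightarrow> 1) (at_right \<alpha>) \<and>
     ((u \<circ> real_of_ereal) \<longlongrightarrow> 0) (at_left \<beta>) \<and>
     ((flux p d u \<circ> real_of_ereal) \<longlongrightarrow> 0) (at_right \<alpha>) \<and>
     ((flux p d u \<circ> real_of_ereal) \<longlongrightarrow> 0) (at_left \<beta>)"

definition threshold_speed ::
  "real \<Rightarrow> (real \<Rightarrow> real) \<Rightarrow> (real \<Rightarrow> real) \<Rightarrow> (real \<Rightarrow> real) \<Rightarrow> (real \<Rightarrow> real) \<Rightarrow> real \<Rightarrow> bool" where
  "threshold_speed p f g \<rho> d c\<^sub>0 \<longleftrightarrow>
     (\<forall>c. (\<exists>\<alpha> \<beta> u. travelling_wave p f g \<rho> d c \<alpha> \<beta> u) \<longleftrightarrow> c\<^sub>0 \<le> c)"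

end

theory Submission
  imports Defs "HOL-Complex_Analysis.Great_Picard"
begin

text \<open>
  A wave is strictly decreasing, so \<open>y = d |u'|\<^sup>p\<^sup>-\<^sup>1\<close> is a function of the value \<open>v = u t\<close>. With
  \<open>q = 1 / (p - 1)\<close> it solves \<open>y' = c g - f - \<rho> d\<^sup>q y\<^sup>-\<^sup>q\<close> on \<open>(0, 1)\<close> with zero boundary values, and
  conversely every such \<open>y\<close> yields a wave. Since \<open>u' = - (y / d)\<^sup>q\<close>, everything depends on \<open>y / d\<close> at
  \<open>0\<close>. If \<open>d / v\<close> has a finite limit, then \<open>y / v\<close> tends to \<open>0\<close> or to \<open>c g(0) - f(0)\<close>. The second value
  is impossible for \<open>c > c*\<close>: \<open>y\<close> would start above the solution for \<open>c*\<close>, and their difference, which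
  grows at least like \<open>(c - c*) \<integral> g\<close>, could not vanish at \<open>1\<close>. If the limit is \<open>0 < c* g(0) - f(0)\<close> for
  \<open>c = c*\<close>, then the solution for a slightly smaller speed with \<open>y(1) = 0\<close> also vanishes at \<open>0\<close>,
  contradicting the minimality of \<open>c*\<close>.
\<close>

subsection \<open>Differential inequalities\<close>

text \<open>Monotonicity takes its place: the right-hand side increases with \<open>y\<close>, hence
  where one solution lies above another, the derivative of their difference is at least the
  difference of their \<open>h\<close> terms. Gaps thus persist from left to right. This one
  comparison excludes the steep slope for speeds above \<open>cstar\<close>, and it also keeps a
  backward solution for a smaller speed close to \<open>y0\<close>, since a large gap could not
  close before \<open>1\<close>. At \<open>0\<close> everything hinges on
  \<open>R v * v powr - q = \<rho> v * (d v / v) powr q\<close>, which tends to \<open>0\<close>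
  with \<open>\<rho>\<close> as soon as \<open>d v / v\<close> stays bounded: along any line of
  positive slope through the origin the singular term disappears, and the equation prescribes the
  derivative \<open>h 0\<close> in the limit.\<close>

lemma negative_left_of_upcrossing:
  fixes k :: "real \<Rightarrow> real"
  assumes der: "\<And>x. 0 < x \<Longrightarrow> x \<le> b \<Longrightarrow> (k has_real_derivative k' x) (at x)"
    and up: "\<And>x. 0 < x \<Longrightarrow> x < b \<Longrightarrow> k x = 0 \<Longrightarrow> 0 < k' x"
    and b: "k b < 0" and v: "0 < v" "v < b"
  shows "k v < 0"
proof (rule ccontr)
  assume kv: "\<not> k v < 0"
  have cont: "continuous_on {x..b} k" if "0 < x" for x
    using that by (intro DERIV_continuous_on[OF has_field_derivative_at_within[OF der]]) auto
  \<comment> \<open>The last zero of \<open>k\<close> in \<open>{v..b}\<close> is an upcrossing, so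
    \<open>k\<close> is positive just after it; being negative at \<open>b\<close>, \<open>k\<close>
    would have to vanish once more.\<close>
  define S where "S = {x \<in> {v..b}. k x = 0}"
  have "closed S"
    unfolding S_def using cont v by (intro continuous_closed_preimage_constant) auto
  moreover have "bounded S"
    by (rule bounded_subset[of "{v..b}"]) (auto simp: S_def)
  ultimately have "compact S" by (simp add: compact_eq_bounded_closed)
  moreover have "S \<noteq> {}"
  proof -
    have "\<exists>x\<ge>v. x \<le> b \<and> k x = 0"
      using kv b v cont by (intro IVT2') auto
    then show ?thesis by (auto simp: S_def)
  qed
  ultimately obtain x where x: "x \<in> S" and max: "\<And>y. y \<in> S \<Longrightarrow> y \<le> x"
    using compact_attains_sup by metis
  have xb: "0 < x" "x < b" "k x = 0"
    using x b v by (cases "x = b"; auto simp: S_def)+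
  obtain e where e: "e > 0" "\<And>h. 0 < h \<Longrightarrow> h < e \<Longrightarrow> k x < k (x + h)"
    using DERIV_pos_inc_right[OF der[of x] up[of x]] xb by auto
  define h where "h = min (e / 2) ((b - x) / 2)"
  have h: "0 < h" "h < e" "x + h < b"
    using e xb by (auto simp: h_def min_def field_simps)
  then have "0 < k (x + h)" using e(2)[of h] xb by simp
  then have "\<exists>z\<ge>x + h. z \<le> b \<and> k z = 0"
    using b h xb cont[of "x + h"] by (intro IVT2') auto
  then obtain z where z: "x + h \<le> z" "z \<le> b" "k z = 0" by blast
  then have "z \<in> S" using x h by (auto simp: S_def)
  from max[OF this] show False using z(1) h(1) by linarith
qed

text \<open>As long as \<open>k\<close> is positive, \<open>k - P\<close> is nondecreasing, and
  \<open>pos\<close> says that the resulting lower bound for \<open>k\<close> is itself positive; so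
  there is no first point where \<open>k\<close> fails to be positive. The derivative inequality is
  asked for only where \<open>0 < k x\<close>, because the singular terms of two profiles compare
  favourably only where the first profile is the larger one.\<close>

lemma growth_bound_while_positive:
  fixes k P :: "real \<Rightarrow> real"
  assumes der: "\<And>x. a \<le> x \<Longrightarrow> x < b \<Longrightarrow> (k has_real_derivative k' x) (at x)"
    and derP: "\<And>x. a \<le> x \<Longrightarrow> x < b \<Longrightarrow> (P has_real_derivative P' x) (at x)"
    and le: "\<And>x. a \<le> x \<Longrightarrow> x < b \<Longrightarrow> 0 < k x \<Longrightarrow> P' x \<le> k' x"
    and pos: "\<And>x. a \<le> x \<Longrightarrow> x < b \<Longrightarrow> 0 < k a + P x - P a"
    and v: "a \<le> v" "v < b"
  shows "k a + P v - P a \<le> k v"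
proof -
  have contk: "continuous_on {a..v} k"
    using v by (intro DERIV_continuous_on[OF has_field_derivative_at_within[OF der]]) auto
  have contP: "continuous_on {a..v} P"
    using v by (intro DERIV_continuous_on[OF has_field_derivative_at_within[OF derP]]) auto
  have mono: "k a - P a \<le> k x - P x" if x: "a \<le> x" "x \<le> v" and p: "\<And>y. a < y \<Longrightarrow> y < x \<Longrightarrow> 0 < k y" for x
  proof (rule DERIV_nonneg_imp_increasing_open[OF x(1)])
    show "continuous_on {a..x} (\<lambda>x. k x - P x)"
      using contk contP x by (intro continuous_on_diff) (auto intro: continuous_on_subset)
    fix y assume y: "a < y" "y < x"
    then have "((\<lambda>x. k x - P x) has_real_derivative (k' y - P' y)) (at y)"
      using x v by (intro DERIV_diff der derP) auto
    then show "\<exists>D. ((\<lambda>x. k x - P x) has_real_derivative D) (at y) \<and> 0 \<le> D"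
      using le[of y] p[of y] y x v by (intro exI[of _ "k' y - P' y"]) auto
  qed
  have "0 < k x" if x: "a \<le> x" "x \<le> v" for x
  proof (rule ccontr)
    assume "\<not> 0 < k x"
    define S where "S = {x \<in> {a..v}. k x \<le> 0}"
    have "closed S"
      unfolding S_def using contk by (intro continuous_on_closed_Collect_le) (auto intro: continuous_intros)
    moreover have "bounded S"
      by (rule bounded_subset[of "{a..v}"]) (auto simp: S_def)
    ultimately have "compact S" by (simp add: compact_eq_bounded_closed)
    moreover have "S \<noteq> {}" using x \<open>\<not> 0 < k x\<close> by (auto simp: S_def)
    ultimately obtain z where z: "z \<in> S" and min: "\<And>y. y \<in> S \<Longrightarrow> z \<le> y"
      using compact_attains_inf by metis
    have "0 < k y" if "a < y" "y < z" for y
      using min[of y] that z by (auto simp: S_def not_le[symmetric])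
    then have "k a - P a \<le> k z - P z" using z by (intro mono) (auto simp: S_def)
    then show False using pos[of z] z v by (auto simp: S_def)
  qed
  then show ?thesis using mono[of v] v by auto
qed

subsection \<open>The first-order reduction\<close>

text \<open>Along a wave, \<open>y\<close> is minus the flux as a function of the value \<open>v = u t\<close>; below,
  \<open>q = 1 / (p - 1)\<close>, \<open>h v = c * g v - f v\<close> and \<open>R v = \<rho> v * d v powr q\<close>.\<close>

definition profile :: "real \<Rightarrow> (real \<Rightarrow> real) \<Rightarrow> (real \<Rightarrow> real) \<Rightarrow> (real \<Rightarrow> real) \<Rightarrow> bool" where
  "profile q h R y \<longleftrightarrow>
     (\<forall>v\<in>{0<..<1}. 0 < y v \<and> (y has_real_derivative h v - R v * y v powr - q) (at v)) \<and>
     (y \<longlongrightarrow> 0) (at_right 0) \<and> (y \<longlongrightarrow> 0) (at_left 1)"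

lemma profileD:
  assumes "profile q h R y"
  shows "\<And>v. 0 < v \<Longrightarrow> v < 1 \<Longrightarrow> 0 < y v"
    and "\<And>v. 0 < v \<Longrightarrow> v < 1 \<Longrightarrow> (y has_real_derivative h v - R v * y v powr - q) (at v)"
    and "(y \<longlongrightarrow> 0) (at_right 0)" and "(y \<longlongrightarrow> 0) (at_left 1)"
  using assms by (auto simp: profile_def)

lemma eventually_at_right_0_less: "0 < a \<Longrightarrow> \<forall>\<^sub>F v in at_right 0. 0 < v \<and> v < (a::real)"
  by (auto simp: eventually_at_right_field)

lemma eventually_at_right_0_obtain:
  assumes "\<forall>\<^sub>F v in at_right (0::real). P v"
  obtains b where "0 < b" "b < 1" "\<And>v. 0 < v \<Longrightarrow> v \<le> b \<Longrightarrow> P v"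
proof -
  obtain b where b: "b > 0" "\<And>v. 0 < v \<Longrightarrow> v < b \<Longrightarrow> P v"
    using assms unfolding eventually_at_right_field by blast
  show thesis by (rule that[of "min (b/2) (1/2)"]) (use b in auto)
qed

text \<open>Nothing is known about the value of \<open>y\<close> at \<open>0\<close> itself, so the
  monotonicity argument runs on \<open>{x..v}\<close> with \<open>0 < x\<close>, and then
  \<open>x\<close> tends to \<open>0\<close>.\<close>

lemma le_mult_of_deriv_le:
  fixes y :: "real \<Rightarrow> real"
  assumes lim: "(y \<longlongrightarrow> 0) (at_right 0)"
    and der: "\<And>x. 0 < x \<Longrightarrow> x \<le> b \<Longrightarrow> (y has_real_derivative y' x) (at x)"
    and le: "\<And>x. 0 < x \<Longrightarrow> x \<le> b \<Longrightarrow> y' x \<le> B"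
    and v: "0 < v" "v \<le> b"
  shows "y v \<le> B * v"
proof -
  have "y v - B * v \<le> y x - B * x" if x: "0 < x" "x < v" for x
  proof (rule DERIV_nonpos_imp_nonincreasing[where f = "\<lambda>x. y x - B * x"])
    show "x \<le> v" using x by simp
    fix z assume z: "x \<le> z" "z \<le> v"
    then have "((\<lambda>x. y x - B * x) has_real_derivative (y' z - B)) (at z)"
      using x v by (auto intro!: derivative_eq_intros der)
    then show "\<exists>D. ((\<lambda>x. y x - B * x) has_real_derivative D) (at z) \<and> D \<le> 0"
      using le[of z] z x v by (intro exI[of _ "y' z - B"]) auto
  qed
  then have ev: "\<forall>\<^sub>F x in at_right 0. y v - B * v \<le> y x - B * x"
    using eventually_at_right_0_less[OF v(1)] by (auto elim!: eventually_mono)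
  have "((\<lambda>x. y x - B * x) \<longlongrightarrow> 0 - B * 0) (at_right 0)"
    by (intro tendsto_intros lim)
  from tendsto_lowerbound[OF this ev] show ?thesis by simp
qed

subsection \<open>Existence for the terminal value problem\<close>

lemma integral_tail_continuous:
  fixes f :: "real \<Rightarrow> real"
  assumes "f integrable_on {a..b}"
  shows "continuous_on {a..b} (\<lambda>v. integral {v..b} f)"
proof -
  have eq: "integral {a..b} f - integral {a..v} f = integral {v..b} f" if "v \<in> {a..b}" for v
    using Henstock_Kurzweil_Integration.integral_combine[of a v b f] that assms by simp
  have "continuous_on {a..b} (\<lambda>v. integral {a..b} f - integral {a..v} f)"
    by (rule continuous_on_diff[OF continuous_on_const indefinite_integral_continuous_1[OF assms]])
  then show ?thesis by (rule continuous_on_eq) (rule eq)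
qed

text \<open>Tonelli's scheme: delaying the argument of the unknown by \<open>1 / N\<close> makes the integral
  equation explicit, so that it is solved after \<open>N\<close> Picard iterations.\<close>

lemma delayed_integral_equation:
  fixes K :: "real \<Rightarrow> real" and F :: "real \<Rightarrow> real \<Rightarrow> real" and N :: nat
  assumes K: "continuous_on {0..1} K"
    and F: "continuous_on ({0..1} \<times> UNIV) (\<lambda>(s, x). F s x)"
    and bound: "\<And>s x. s \<in> {0..1} \<Longrightarrow> \<bar>x\<bar> \<le> B \<Longrightarrow> \<bar>F s x\<bar> \<le> M"
    and M: "0 \<le> M"
    and KB: "\<And>v. v \<in> {0..1} \<Longrightarrow> \<bar>K v\<bar> + M \<le> B"
    and N: "0 < N"
  obtains w where "continuous_on {0..1} w" "\<And>v. v \<in> {0..1} \<Longrightarrow> \<bar>w v\<bar> \<le> B"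
    "\<And>v. v \<in> {0..1} \<Longrightarrow> w v = K v + integral {v..1} (\<lambda>s. F s (w (min 1 (s + 1 / N))))"
proof -
  define \<Phi> where "\<Phi> w v = K v + integral {v..1} (\<lambda>s. F s (w (min 1 (s + 1 / N))))" for w v
  \<comment> \<open>The constant \<open>K 1\<close> is the correct value at \<open>v = 1\<close>,
    which makes the base case of \<open>stable\<close> true.\<close>
  define W where "W k = (\<Phi> ^^ k) (\<lambda>_. K 1)" for k
  have W_Suc: "W (Suc k) = \<Phi> (W k)" for k by (simp add: W_def)
  have cF: "continuous_on {0..1} (\<lambda>s. F s (w (min 1 (s + 1 / N))))"
    if w: "continuous_on {0..1} w" for w
  proof -
    have "continuous_on {0..1} (\<lambda>s. w (min 1 (s + 1 / N)))"
      by (rule continuous_on_compose2[OF w]) (auto intro!: continuous_intros)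
    then have "continuous_on {0..1} (\<lambda>s. (s, w (min 1 (s + 1 / N))))"
      by (intro continuous_intros)
    from continuous_on_compose2[OF F this] show ?thesis by auto
  qed
  have W: "continuous_on {0..1} (W k) \<and> (\<forall>v\<in>{0..1}. \<bar>W k v\<bar> \<le> B)" for k
  proof (induction k)
    case 0
    show ?case using KB[of 1] M by (auto simp: W_def)
  next
    case (Suc k)
    let ?f = "\<lambda>s. F s (W k (min 1 (s + 1 / N)))"
    have int: "?f integrable_on {0..1}"
      using cF[of "W k"] Suc by (intro integrable_continuous_real) auto
    have "continuous_on {0..1} (W (Suc k))"
      unfolding W_Suc \<Phi>_def by (intro continuous_on_add K integral_tail_continuous int)
    moreover have "\<bar>W (Suc k) v\<bar> \<le> B" if v: "v \<in> {0..1}" for v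
    proof -
      have "norm (integral {v..1} ?f) \<le> integral {v..1} (\<lambda>_. M)"
      proof (rule integral_norm_bound_integral)
        show "?f integrable_on {v..1}"
          using int v by (auto intro: integrable_on_subinterval)
        show "norm (?f s) \<le> M" if "s \<in> {v..1}" for s
          using bound[of s "W k (min 1 (s + 1 / N))"] that v Suc N by auto
      qed (auto intro: integrable_const_ivl)
      also have "\<dots> = (1 - v) * M" using v by simp
      also have "\<dots> \<le> 1 * M" using v M by (intro mult_right_mono) auto
      finally show ?thesis using KB[OF v] unfolding W_Suc \<Phi>_def by auto
    qed
    ultimately show ?case by blast
  qed
  \<comment> \<open>At \<open>s\<close> the delayed equation looks at the unknown only
    \<open>1 / N\<close> further right, or at \<open>1\<close>. Each iteration therefore settles one
    more piece of length \<open>1 / N\<close>, counted from the right end.\<close>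
  have stable: "\<forall>v\<in>{0..1}. 1 - k / N \<le> v \<longrightarrow> W (Suc k) v = W k v" for k
  proof (induction k)
    case 0
    then show ?case by (auto simp: W_def \<Phi>_def)
  next
    case (Suc k)
    have "\<Phi> (W (Suc k)) v = \<Phi> (W k) v" if v: "v \<in> {0..1}" "1 - Suc k / N \<le> v" for v
    proof -
      have "W (Suc k) (min 1 (s + 1 / N)) = W k (min 1 (s + 1 / N))" if s: "s \<in> {v..1}" for s
      proof -
        have "1 - k / N \<le> min 1 (s + 1 / N)"
          using v s N by (auto simp: add_divide_distrib min_def)
        then show ?thesis using Suc v s N by auto
      qed
      then show ?thesis unfolding \<Phi>_def by (auto intro!: integral_cong)
    qed
    then show ?case by (auto simp: W_Suc[of "Suc k"] W_Suc[of k])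
  qed
  have "W N v = \<Phi> (W N) v" if "v \<in> {0..1}" for v
    using stable[of N] that N W_Suc by auto
  then show thesis using W[of N] by (intro that[of "W N"]) (auto simp: \<Phi>_def)
qed

text \<open>Compactness replaces contraction, as \<open>F\<close> is merely continuous in its second
  argument. The delayed solutions are bounded by \<open>B\<close>, and after subtracting
  \<open>K\<close> they are Lipschitz with constant \<open>M\<close>, so Arzela-Ascoli gives a
  uniformly convergent subsequence. Dominated convergence carries the equation over to its limit.
  \<open>KB\<close> makes the ball of radius \<open>B\<close> invariant, so \<open>F\<close> has to
  be bounded only there.\<close>

lemma terminal_value_problem:
  fixes K :: "real \<Rightarrow> real" and F :: "real \<Rightarrow> real \<Rightarrow> real"
  assumes K: "continuous_on {0..1} K"
    and F: "continuous_on ({0..1} \<times> UNIV) (\<lambda>(s, x). F s x)"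
    and bound: "\<And>s x. s \<in> {0..1} \<Longrightarrow> \<bar>x\<bar> \<le> B \<Longrightarrow> \<bar>F s x\<bar> \<le> M"
    and M: "0 \<le> M"
    and KB: "\<And>v. v \<in> {0..1} \<Longrightarrow> \<bar>K v\<bar> + M \<le> B"
  obtains w where "continuous_on {0..1} w"
    "\<And>v. v \<in> {0..1} \<Longrightarrow> w v = K v + integral {v..1} (\<lambda>s. F s (w s))"
proof -
  let ?\<tau> = "\<lambda>n s. min 1 (s + 1 / real (Suc n))"
  have "\<exists>w. continuous_on {0..1} w \<and> (\<forall>v\<in>{0..1}. \<bar>w v\<bar> \<le> B \<and>
     w v = K v + integral {v..1} (\<lambda>s. F s (w (?\<tau> n s))))" for n
    by (rule delayed_integral_equation[OF K F bound M KB, of "Suc n"]) auto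
  then obtain W where cW: "\<And>n. continuous_on {0..1} (W n)"
    and WB: "\<And>n v. v \<in> {0..1} \<Longrightarrow> \<bar>W n v\<bar> \<le> B"
    and Weq: "\<And>n v. v \<in> {0..1} \<Longrightarrow> W n v = K v + integral {v..1} (\<lambda>s. F s (W n (?\<tau> n s)))"
    by metis
  have cF: "continuous_on {0..1} (\<lambda>s. F s (w s))" if w: "continuous_on {0..1} w" for w
  proof -
    have "continuous_on {0..1} (\<lambda>s. (s, w s))" by (intro continuous_intros w)
    from continuous_on_compose2[OF F this] show ?thesis by auto
  qed
  have cWt: "continuous_on {0..1} (\<lambda>s. W n (?\<tau> n s))" for n
    by (rule continuous_on_compose2[OF cW]) (auto intro!: continuous_intros)
  have int: "(\<lambda>s. F s (W n (?\<tau> n s))) integrable_on {0..1}" for n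
    by (intro integrable_continuous_real cF cWt)
  have Fb: "\<bar>F s (W n (?\<tau> n s))\<bar> \<le> M" if "s \<in> {0..1}" for n s
    using that by (intro bound WB) auto
  have lip: "\<bar>(W n v - K v) - (W n v' - K v')\<bar> \<le> M * (v' - v)"
    if v: "v \<in> {0..1}" "v' \<in> {0..1}" "v \<le> v'" for n v v'
  proof -
    let ?f = "\<lambda>s. F s (W n (?\<tau> n s))"
    have "integral {v..v'} ?f + integral {v'..1} ?f = integral {v..1} ?f"
      using v int[of n] by (intro Henstock_Kurzweil_Integration.integral_combine)
        (auto intro: integrable_on_subinterval)
    then have "(W n v - K v) - (W n v' - K v') = integral {v..v'} ?f"
      using Weq[of v n] Weq[of v' n] v by simp
    moreover have "norm (integral {v..v'} ?f) \<le> integral {v..v'} (\<lambda>_. M)"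
      using v int[of n] Fb by (intro integral_norm_bound_integral)
        (auto intro: integrable_on_subinterval integrable_const_ivl)
    ultimately show ?thesis using v by (simp add: mult.commute)
  qed
  have lip': "\<bar>(W n v - K v) - (W n v' - K v')\<bar> \<le> M * \<bar>v - v'\<bar>"
    if v: "v \<in> {0..1}" "v' \<in> {0..1}" for n v v'
    using lip[of v v' n] lip[of v' v n] v by (cases "v \<le> v'") (auto simp: abs_minus_commute)
  have equi: "\<exists>d>0. \<forall>n y. y \<in> {0..1} \<and> norm (x - y) < d \<longrightarrow> norm (W n x - W n y) < e"
    if x: "x \<in> {0..1}" and e: "0 < e" for x e
  proof -
    obtain d where d: "d > 0" "\<And>y. y \<in> {0..1} \<Longrightarrow> dist y x < d \<Longrightarrow> dist (K y) (K x) < e / 2"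
      using K x e unfolding continuous_on_iff by (metis half_gt_zero)
    \<comment> \<open>\<open>M + 1\<close> instead of \<open>M\<close>, since \<open>M\<close> may
      be \<open>0\<close>.\<close>
    define d' where "d' = min d (e / (2 * (M + 1)))"
    have "norm (W n x - W n y) < e" if y: "y \<in> {0..1}" "norm (x - y) < d'" for n y
    proof -
      have "M * \<bar>x - y\<bar> \<le> (M + 1) * \<bar>x - y\<bar>" by (simp add: mult_right_mono)
      also have "\<dots> \<le> (M + 1) * (e / (2 * (M + 1)))"
        using y M by (intro mult_left_mono) (auto simp: d'_def)
      also have "\<dots> = e / 2" using M by (simp add: field_simps)
      finally have "\<bar>(W n x - K x) - (W n y - K y)\<bar> \<le> e / 2" using lip'[OF x y(1), of n] by simp
      moreover have "\<bar>K x - K y\<bar> < e / 2"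
        using d(2)[of y] y by (auto simp: d'_def dist_real_def abs_minus_commute)
      ultimately show ?thesis unfolding real_norm_def by linarith
    qed
    moreover have "d' > 0" using d e M by (auto simp: d'_def)
    ultimately show ?thesis by blast
  qed
  obtain w k where cw: "continuous_on {0..1} w" and k: "strict_mono (k :: nat \<Rightarrow> nat)"
    and unif: "\<And>e. 0 < e \<Longrightarrow> \<exists>N. \<forall>n x. n \<ge> N \<and> x \<in> {0..1} \<longrightarrow> norm (W (k n) x - w x) < e"
    using Arzela_Ascoli[of "{0..1}" W B, OF compact_Icc _ equi] WB by auto
  have conv: "(\<lambda>n. W (k n) v) \<longlonglongrightarrow> w v" if "v \<in> {0..1}" for v
    unfolding LIMSEQ_iff using unif that by blast
  \<comment> \<open>The delay tends to \<open>0\<close> along the subsequence, and equicontinuity at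
    \<open>s\<close> makes the shifted argument harmless uniformly in the index.\<close>
  have conv': "(\<lambda>n. W (k n) (?\<tau> (k n) s)) \<longlonglongrightarrow> w s" if s: "s \<in> {0..1}" for s
  proof (rule LIMSEQ_I)
    fix e :: real assume e: "0 < e"
    obtain d where d: "d > 0" "\<And>n y. y \<in> {0..1} \<Longrightarrow> norm (s - y) < d \<Longrightarrow> norm (W n s - W n y) < e / 2"
      using equi[OF s, of "e / 2"] e by auto
    obtain N1 where N1: "\<And>n. n \<ge> N1 \<Longrightarrow> norm (W (k n) s - w s) < e / 2"
      using unif[of "e / 2"] e s by auto
    obtain N2 where N2: "inverse (real (Suc N2)) < d" using reals_Archimedean d(1) by blast
    have "norm (W (k n) (?\<tau> (k n) s) - w s) < e" if n: "n \<ge> max N1 N2" for n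
    proof -
      have "1 / real (Suc (k n)) \<le> inverse (real (Suc N2))"
        using n seq_suble[OF k, of n] by (auto simp: field_simps)
      then have "norm (s - ?\<tau> (k n) s) < d" using N2 s by (auto simp: min_def)
      then have "norm (W (k n) s - W (k n) (?\<tau> (k n) s)) < e / 2" using s by (intro d(2)) auto
      then show ?thesis using N1[of n] n unfolding real_norm_def max.bounded_iff by linarith
    qed
    then show "\<exists>no. \<forall>n\<ge>no. norm (W (k n) (?\<tau> (k n) s) - w s) < e" by blast
  qed
  have "w v = K v + integral {v..1} (\<lambda>s. F s (w s))" if v: "v \<in> {0..1}" for v
  proof -
    have "(\<lambda>n. integral {v..1} (\<lambda>s. F s (W (k n) (?\<tau> (k n) s)))) \<longlonglongrightarrow> integral {v..1} (\<lambda>s. F s (w s))"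
    proof (rule dominated_convergence(2))
      show "(\<lambda>s. F s (W (k n) (?\<tau> (k n) s))) integrable_on {v..1}" for n
        using int[of "k n"] v by (auto intro: integrable_on_subinterval)
      show "(\<lambda>_. M) integrable_on {v..1}" by (rule integrable_const_ivl)
      show "norm (F s (W (k n) (?\<tau> (k n) s))) \<le> M" if "s \<in> {v..1}" for n s
        using Fb[of s "k n"] that v by auto
      show "(\<lambda>n. F s (W (k n) (?\<tau> (k n) s))) \<longlonglongrightarrow> F s (w s)" if s: "s \<in> {v..1}" for s
      proof -
        have s01: "s \<in> {0..1}" using s v by auto
        have "continuous_on UNIV (Pair s)"
          by (intro continuous_intros)
        moreover have "range (Pair s) \<subseteq> {0..1} \<times> UNIV"
          using s01 by auto
        ultimately have "continuous_on UNIV (F s)"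
          using continuous_on_compose2[OF F, of UNIV "Pair s"] by simp
        then have "isCont (F s) (w s)" by (simp add: continuous_on_eq_continuous_at)
        from isCont_tendsto_compose[OF this conv'[OF s01]] show ?thesis .
      qed
    qed
    then have "(\<lambda>n. W (k n) v) \<longlonglongrightarrow> K v + integral {v..1} (\<lambda>s. F s (w s))"
      using Weq[OF v] by (auto intro: tendsto_intros)
    with conv[OF v] show ?thesis by (rule LIMSEQ_unique)
  qed
  with cw show thesis by (rule that)
qed

lemma integral_tail_has_real_derivative:
  fixes f :: "real \<Rightarrow> real"
  assumes f: "f integrable_on {a..b}" and cont: "isCont f v" and v: "a < v" "v < b"
  shows "((\<lambda>v. integral {v..b} f) has_real_derivative - f v) (at v)"
proof -
  have "((\<lambda>v. integral {a..v} f) has_vector_derivative f v) (at v within {a..b})"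
    using integral_has_vector_derivative_continuous_at[of f a b v "{}"] f v cont
    by (simp add: continuous_at_imp_continuous_at_within)
  then have "((\<lambda>v. integral {a..v} f) has_real_derivative f v) (at v)"
    using v by (simp add: has_real_derivative_iff_has_vector_derivative at_within_Icc_at)
  then have "((\<lambda>v. integral {a..b} f - integral {a..v} f) has_real_derivative - f v) (at v)"
    by (auto intro!: derivative_eq_intros)
  then show ?thesis
  proof (rule has_field_derivative_transform_within_open)
    show "open {a<..<b}" "v \<in> {a<..<b}" using v by auto
    show "integral {a..b} f - integral {a..x} f = integral {x..b} f" if "x \<in> {a<..<b}" for x
      using Henstock_Kurzweil_Integration.integral_combine[of a x b f] that f by simp
  qed
qed

lemma continuous_on_Icc_bounded:
  fixes f :: "real \<Rightarrow> real"
  assumes "continuous_on {a..b} f"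
  obtains C where "\<And>x. x \<in> {a..b} \<Longrightarrow> \<bar>f x\<bar> \<le> C"
  using compact_imp_bounded[OF compact_continuous_image[OF assms compact_Icc]] that
  unfolding bounded_iff by force

text \<open>A power with exponent \<open>r < 1\<close> is negligible against \<open>B\<close> for
  large \<open>B\<close>. This yields the radius of the invariant ball required by
  \<open>terminal_value_problem\<close>.\<close>

lemma sublinear_growth_bound:
  fixes r a b c :: real
  assumes r: "0 < r" "r < 1" and c: "0 < c"
  obtains B where "0 < B" "a + b * (c * B) powr r \<le> B"
proof -
  have "eventually (\<lambda>B. a + b * (c * B) powr r \<le> B) at_top"
  proof -
    have "((\<lambda>B. a / B + b * c powr r * B powr (r - 1)) \<longlongrightarrow> 0 + b * c powr r * 0) at_top"
      using r by (intro tendsto_intros tendsto_neg_powr filterlim_ident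
          real_tendsto_divide_at_top[OF tendsto_const]) auto
    then have "eventually (\<lambda>B. a / B + b * c powr r * B powr (r - 1) < 1) at_top"
      by (intro order_tendstoD) auto
    then show ?thesis using eventually_gt_at_top[of 0]
    proof eventually_elim
      case (elim B)
      have "a + b * (c * B) powr r = (a / B + b * c powr r * B powr (r - 1)) * B"
        using elim c by (simp add: powr_mult powr_diff field_simps)
      also have "\<dots> \<le> 1 * B" using elim by (intro mult_right_mono) auto
      finally show ?case by simp
    qed
  qed
  then have "eventually (\<lambda>B. 0 < B \<and> a + b * (c * B) powr r \<le> B) at_top"
    using eventually_gt_at_top[of 0] by eventually_elim auto
  then show thesis using that eventually_happens'[OF trivial_limit_at_top_linorder] by blast
qed

text \<open>The unknown \<open>w = y powr (q + 1) / (q + 1)\<close> satisfies an equation without singularity.\<close>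

lemma profile_from_1:
  fixes h R :: "real \<Rightarrow> real"
  assumes q: "0 < q"
    and h: "continuous_on {0..1} h"
    and Rint: "R integrable_on {0..1}"
    and Rcont: "continuous_on {0<..<1} R"
    and Rpos: "\<And>v. 0 < v \<Longrightarrow> v < 1 \<Longrightarrow> 0 < R v"
  obtains y where "\<And>v. 0 < v \<Longrightarrow> v < 1 \<Longrightarrow> 0 < y v"
    "\<And>v. 0 < v \<Longrightarrow> v < 1 \<Longrightarrow> (y has_real_derivative h v - R v * y v powr - q) (at v)"
    "(y \<longlongrightarrow> 0) (at_left 1)"
proof -
  \<comment> \<open>Multiplying the equation for \<open>y\<close> by \<open>y powr q\<close> gives
    \<open>w' = h * y powr q - R\<close> with \<open>y powr q = ((q + 1) * w) powr r\<close>. As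
    \<open>r < 1\<close>, this is continuous but not Lipschitz at \<open>w = 0\<close>.\<close>
  define r where "r = q / (q + 1)"
  have r: "0 < r" "r < 1" using q by (auto simp: r_def)
  \<comment> \<open>Truncation by \<open>max 0\<close> makes \<open>\<phi>\<close> continuous on the
    whole line; that \<open>w\<close> is positive is known only after it has been
    constructed.\<close>
  define \<phi> where "\<phi> x = ((q + 1) * max 0 x) powr r" for x
  define K where "K v = integral {v..1} R" for v
  have K: "continuous_on {0..1} K" unfolding K_def by (rule integral_tail_continuous[OF Rint])
  obtain K0 where K0: "\<And>v. v \<in> {0..1} \<Longrightarrow> \<bar>K v\<bar> \<le> K0"
    using continuous_on_Icc_bounded[OF K] by blast
  obtain H where H: "\<And>v. v \<in> {0..1} \<Longrightarrow> \<bar>h v\<bar> \<le> H"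
    using continuous_on_Icc_bounded[OF h] by blast
  have H0: "0 \<le> H" using H[of 0] by auto
  obtain B where B: "0 < B" "K0 + H * ((q + 1) * B) powr r \<le> B"
    using sublinear_growth_bound[OF r, of "q + 1" K0 H] q by auto
  define M where "M = H * \<phi> B"
  have \<phi>cont: "continuous_on UNIV \<phi>"
    unfolding \<phi>_def using q r by (intro continuous_on_powr' continuous_intros) auto
  have \<phi>mono: "\<phi> x \<le> \<phi> B" if "x \<le> B" for x
    unfolding \<phi>_def using that q r by (intro powr_mono2 mult_left_mono) auto
  have \<phi>0: "0 \<le> \<phi> x" for x by (simp add: \<phi>_def)
  have F: "continuous_on ({0..1} \<times> UNIV) (\<lambda>(s, x). - h s * \<phi> x)"
    unfolding case_prod_beta
    by (intro continuous_intros continuous_on_compose2[OF h] continuous_on_compose2[OF \<phi>cont]) auto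
  obtain w where w: "continuous_on {0..1} w"
    and weq: "\<And>v. v \<in> {0..1} \<Longrightarrow> w v = K v + integral {v..1} (\<lambda>s. - h s * \<phi> (w s))"
  proof (rule terminal_value_problem[OF K F])
    show "\<bar>- h s * \<phi> x\<bar> \<le> M" if "s \<in> {0..1}" "\<bar>x\<bar> \<le> B" for s x
      unfolding M_def using H[OF that(1)] \<phi>mono[of x] \<phi>0[of x] that H0
      by (auto simp: abs_mult intro!: mult_mono)
    show "0 \<le> M" using H0 \<phi>0 by (simp add: M_def)
    show "\<bar>K v\<bar> + M \<le> B" if "v \<in> {0..1}" for v
      using K0[OF that] B by (simp add: M_def \<phi>_def)
  qed blast
  have cont': "continuous_on {0..1} (\<lambda>s. - h s * \<phi> (w s))"
    by (intro continuous_intros h w continuous_on_compose2[OF \<phi>cont]) auto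
  have der: "(w has_real_derivative h v * \<phi> (w v) - R v) (at v)" if v: "0 < v" "v < 1" for v
  proof -
    have "isCont R v"
      using Rcont v by (simp add: continuous_on_eq_continuous_at)
    then have 1: "(K has_real_derivative - R v) (at v)"
      unfolding K_def using v by (intro integral_tail_has_real_derivative[OF Rint])
    have "isCont (\<lambda>s. - h s * \<phi> (w s)) v"
      by (rule continuous_on_interior[OF cont']) (use v in auto)
    then have 2: "((\<lambda>v. integral {v..1} (\<lambda>s. - h s * \<phi> (w s))) has_real_derivative - (- h v * \<phi> (w v))) (at v)"
      using v by (intro integral_tail_has_real_derivative[OF integrable_continuous_real[OF cont']])
    have "((\<lambda>v. K v + integral {v..1} (\<lambda>s. - h s * \<phi> (w s))) has_real_derivative h v * \<phi> (w v) - R v) (at v)"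
      using DERIV_add[OF 1 2] by simp
    then show ?thesis
      by (rule has_field_derivative_transform_within_open[of _ _ _ "{0<..<1}"]) (use v weq in auto)
  qed
  have w1: "w 1 = 0" using weq[of 1] by (simp add: K_def)
  \<comment> \<open>At a minimum with nonpositive value the factor \<open>\<phi>\<close> vanishes,
    leaving \<open>w' = - R < 0\<close>, so \<open>w\<close> would fall further to the right of
    it.\<close>
  have pos: "0 < w v0" if v0: "0 < v0" "v0 < 1" for v0
  proof (rule ccontr)
    assume neg: "\<not> 0 < w v0"
    have "continuous_on {v0..1} w" using continuous_on_subset[OF w] v0 by auto
    then obtain x where x: "x \<in> {v0..1}" and min: "\<And>z. z \<in> {v0..1} \<Longrightarrow> w x \<le> w z"
      using continuous_attains_inf[of "{v0..1}" w] v0 by auto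
    \<comment> \<open>A minimum at \<open>1\<close> leaves no room to the right. In that case
      \<open>w 1 = 0\<close> and \<open>w v0 \<le> 0\<close> show that \<open>v0\<close> is a
      minimum as well.\<close>
    obtain x' where x': "x' \<in> {v0..<1}" "\<And>z. z \<in> {v0..1} \<Longrightarrow> w x' \<le> w z"
    proof (cases "x = 1")
      case True
      then have "w v0 \<le> w z" if "z \<in> {v0..1}" for z using min[OF that] neg w1 by auto
      then show thesis using v0 by (intro that[of v0]) auto
    next
      case False
      then show thesis using x min by (intro that[of x]) auto
    qed
    have "w x' \<le> 0" using x'(2)[of v0] neg v0 by auto
    then have "h x' * \<phi> (w x') - R x' < 0"
      using Rpos[of x'] x' v0 by (simp add: \<phi>_def)
    from DERIV_neg_dec_right[OF der this] x' v0
    obtain e where e: "e > 0" "\<And>d. 0 < d \<Longrightarrow> d < e \<Longrightarrow> w (x' + d) < w x'" by auto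
    define d where "d = min (e / 2) (1 - x')"
    have "0 < d" "d < e" "x' + d \<le> 1" using e(1) x' by (auto simp: d_def)
    then show False using e(2)[of d] x'(2)[of "x' + d"] x'(1) by auto
  qed
  define y where "y v = ((q + 1) * w v) powr (1 / (q + 1))" for v
  have ypos: "0 < y v" if "0 < v" "v < 1" for v
    using pos[OF that] q by (simp add: y_def)
  have yder: "(y has_real_derivative h v - R v * y v powr - q) (at v)" if v: "0 < v" "v < 1" for v
  proof -
    have W: "0 < (q + 1) * w v" using pos[OF v] q by simp
    have "((\<lambda>v. (q + 1) * w v) has_real_derivative (q + 1) * (h v * \<phi> (w v) - R v)) (at v)"
      by (intro DERIV_cmult der v)
    from DERIV_chain2[OF has_real_derivative_powr[OF W, of "1 / (q + 1)"] this]
    moreover have "1 / (q + 1) - 1 = - r" using q by (simp add: r_def field_simps)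
    ultimately have D: "(y has_real_derivative
        ((q + 1) * w v) powr - r * (h v * \<phi> (w v) - R v)) (at v)"
      unfolding y_def using q by simp
    have yq: "y v powr - q = ((q + 1) * w v) powr - r"
      by (simp add: y_def powr_powr r_def)
    have \<phi>w: "\<phi> (w v) = ((q + 1) * w v) powr r"
      using pos[OF v] by (simp add: \<phi>_def)
    have inv: "((q + 1) * w v) powr - r * ((q + 1) * w v) powr r = 1"
      using W by (metis powr_add add.left_inverse powr_zero_eq_one less_irrefl)
    have "a * (h v * b - R v) = h v - R v * a" if "a * b = 1" for a b
      using that by algebra
    from this[OF inv] D show ?thesis by (simp only: yq \<phi>w)
  qed
  have "(w \<longlongrightarrow> w 1) (at_left 1)"
    using w by (auto simp: continuous_on_Icc_at_leftD)
  then have "(y \<longlongrightarrow> ((q + 1) * w 1) powr (1 / (q + 1))) (at_left 1)"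
    unfolding y_def using q pos eventually_at_left_real[of 0 1]
    by (intro tendsto_powr2 tendsto_intros) (auto elim!: eventually_mono simp: less_imp_le)
  then have "(y \<longlongrightarrow> 0) (at_left 1)" by (simp add: w1)
  with ypos yder show thesis by (rule that)
qed

subsection \<open>Slopes at the origin\<close>

text \<open>Equality can occur near \<open>0\<close> only as an upward crossing of \<open>y\<close>
  through \<open>\<omega>\<close>. Hence one point with \<open>y\<close> below
  \<open>\<omega>\<close> forces \<open>y\<close> below \<open>\<omega>\<close> all the way to
  \<open>0\<close>; without such a point the other alternative holds.\<close>

lemma eventually_less_or_ge:
  fixes y \<omega> :: "real \<Rightarrow> real"
  assumes y: "\<forall>\<^sub>F v in at_right 0. (y has_real_derivative y' v) (at v)"
    and \<omega>: "\<forall>\<^sub>F v in at_right 0. (\<omega> has_real_derivative \<omega>' v) (at v)"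
    and up: "\<forall>\<^sub>F v in at_right 0. y v = \<omega> v \<longrightarrow> \<omega>' v < y' v"
  shows "(\<forall>\<^sub>F v in at_right 0. y v < \<omega> v) \<or> (\<forall>\<^sub>F v in at_right 0. \<omega> v \<le> y v)"
proof -
  obtain b where b: "0 < b" and B: "\<And>v. 0 < v \<Longrightarrow> v \<le> b \<Longrightarrow> (y has_real_derivative y' v) (at v) \<and>
      (\<omega> has_real_derivative \<omega>' v) (at v) \<and> (y v = \<omega> v \<longrightarrow> \<omega>' v < y' v)"
    using eventually_at_right_0_obtain[OF eventually_conj[OF y eventually_conj[OF \<omega> up]]] by metis
  show ?thesis
  proof (cases "\<exists>c>0. c \<le> b \<and> y c < \<omega> c")
    case True
    then obtain c where c: "0 < c" "c \<le> b" "y c < \<omega> c" by blast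
    have "y v - \<omega> v < 0" if "0 < v" "v < c" for v
      by (rule negative_left_of_upcrossing[where b = c and k' = "\<lambda>v. y' v - \<omega>' v"])
        (use c B that in \<open>auto intro!: DERIV_diff\<close>)
    then have "\<forall>\<^sub>F v in at_right 0. y v < \<omega> v"
      using eventually_at_right_0_less[OF c(1)] by (auto elim!: eventually_mono)
    then show ?thesis ..
  next
    case False
    then have "\<omega> v \<le> y v" if "0 < v" "v < b" for v
      using that by (meson less_imp_le not_le)
    then have "\<forall>\<^sub>F v in at_right 0. \<omega> v \<le> y v"
      using eventually_at_right_0_less[OF b] by (auto elim!: eventually_mono)
    then show ?thesis ..
  qed
qed

locale profile_at_0 =
  fixes q :: real and h R y :: "real \<Rightarrow> real"
  assumes q: "0 < q" and hcont: "continuous_on {0..1} h"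
    and Rpos: "\<And>v. 0 < v \<Longrightarrow> v < 1 \<Longrightarrow> 0 < R v"
    and prof: "profile q h R y"
begin

lemmas y = profileD[OF prof]

lemma h_tendsto: "(h \<longlongrightarrow> h 0) (at_right 0)"
  using hcont by (auto intro: continuous_on_Icc_at_rightD)

lemma ev01: "\<forall>\<^sub>F v in at_right (0::real). 0 < v \<and> v < 1"
  by (rule eventually_at_right_0_less) simp

lemma y_deriv: "\<forall>\<^sub>F v in at_right 0. (y has_real_derivative h v - R v * y v powr - q) (at v)"
  using ev01 by eventually_elim (auto intro: y)

lemma y_le:
  assumes "h 0 < B"
  shows "\<forall>\<^sub>F v in at_right 0. y v \<le> B * v"
proof -
  have "\<forall>\<^sub>F v in at_right 0. h v < B \<and> 0 < v \<and> v < 1"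
    using order_tendstoD(2)[OF h_tendsto assms] ev01 by eventually_elim auto
  then obtain b where b: "0 < b" "\<And>v. 0 < v \<Longrightarrow> v \<le> b \<Longrightarrow> h v < B \<and> v < 1"
    using eventually_at_right_0_obtain by (metis (no_types, lifting))
  have "y v \<le> B * v" if v: "0 < v" "v \<le> b" for v
  proof (rule le_mult_of_deriv_le[OF y(3) _ _ v])
    fix x assume x: "0 < x" "x \<le> b"
    show "(y has_real_derivative h x - R x * y x powr - q) (at x)"
      using x b by (intro y) auto
    have "0 \<le> R x * y x powr - q" using Rpos[of x] x b by auto
    then show "h x - R x * y x powr - q \<le> B" using b x by fastforce
  qed
  then show ?thesis
    using eventually_at_right_0_less[OF b(1)] by (auto elim!: eventually_mono)
qed

text \<open>If \<open>h 0\<close> were negative, \<open>y_le\<close> with \<open>B = 0\<close> would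
  contradict the positivity of \<open>y\<close>.\<close>

lemma h0_nonneg: "0 \<le> h 0"
proof (rule ccontr)
  assume "\<not> 0 \<le> h 0"
  then have "\<forall>\<^sub>F v in at_right 0. y v \<le> 0 * v" by (intro y_le) auto
  then have "\<forall>\<^sub>F v in at_right (0::real). False"
    using ev01 by eventually_elim (use y(1) in force)
  then show False by simp
qed

lemma slope_le:
  assumes "h 0 < B"
  shows "\<forall>\<^sub>F v in at_right 0. y v / v \<le> B"
  using y_le[OF assms] ev01 by eventually_elim (auto simp: field_simps)

lemma slope_zero:
  assumes "\<And>e. 0 < e \<Longrightarrow> \<forall>\<^sub>F v in at_right 0. y v / v \<le> e"
  shows "((\<lambda>v. y v / v) \<longlongrightarrow> 0) (at_right 0)"
proof (rule tendsto_0_le[where K = 1], rule tendstoI)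
  fix e :: real assume "0 < e"
  then have "\<forall>\<^sub>F v in at_right 0. y v / v \<le> e / 2" by (intro assms) auto
  then show "\<forall>\<^sub>F v in at_right 0. dist (y v / v) 0 < e"
    using ev01
  proof eventually_elim
    case (elim v)
    then have "0 < y v / v" using y(1) by simp
    then show ?case using elim(1) \<open>0 < e\<close> unfolding dist_real_def by linarith
  qed
qed auto

text \<open>The singular term decreases in \<open>y\<close>, so if it vanishes along a lower barrier
  \<open>\<omega>\<close>, it vanishes along \<open>y\<close> too. Then \<open>y'\<close> tends to
  \<open>h 0\<close>, and l'Hopital's rule gives the slope. The barriers used below are multiples of
  \<open>v\<close> and of \<open>d\<close>.\<close>

lemma slope_h0:
  assumes lower: "\<forall>\<^sub>F v in at_right 0. 0 < \<omega> v \<and> \<omega> v \<le> y v"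
    and lim: "((\<lambda>v. R v * \<omega> v powr - q) \<longlongrightarrow> 0) (at_right 0)"
    and h0: "0 < h 0"
  shows "((\<lambda>v. y v / v) \<longlongrightarrow> h 0) (at_right 0)"
proof -
  have "((\<lambda>v. R v * y v powr - q) \<longlongrightarrow> 0) (at_right 0)"
  proof (rule tendsto_sandwich[OF _ _ tendsto_const lim])
    show "\<forall>\<^sub>F v in at_right 0. 0 \<le> R v * y v powr - q"
      using ev01 by eventually_elim (use Rpos in \<open>auto simp: less_imp_le\<close>)
    show "\<forall>\<^sub>F v in at_right 0. R v * y v powr - q \<le> R v * \<omega> v powr - q"
      using lower ev01 
      by eventually_elim (use Rpos q in \<open>auto intro!: mult_left_mono powr_mono2' simp: less_imp_le\<close>)
  qed
  from tendsto_diff[OF h_tendsto this]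
  have lim': "((\<lambda>v. h v - R v * y v powr - q) \<longlongrightarrow> h 0) (at_right 0)" by simp
  show ?thesis
  proof (rule lhopital_right_0[where g' = "\<lambda>_. 1"])
    show "(y \<longlongrightarrow> 0) (at_right 0)" by (rule y)
    show "\<forall>\<^sub>F v in at_right 0. (y has_real_derivative h v - R v * y v powr - q) (at v)"
      by (rule y_deriv)
    show "((\<lambda>v. (h v - R v * y v powr - q) / 1) \<longlongrightarrow> h 0) (at_right 0)"
      using lim' by simp
    show "\<forall>\<^sub>F v in at_right (0::real). v \<noteq> 0" using ev01 by eventually_elim auto
  qed (auto intro: tendsto_ident_at)
qed

lemma scaled_limit:
  assumes "0 < \<mu>" and lim: "((\<lambda>v. R v * \<omega> v powr - q) \<longlongrightarrow> 0) (at_right 0)"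
    and \<omega>: "\<And>v. 0 < v \<Longrightarrow> v < 1 \<Longrightarrow> 0 < \<omega> v"
  shows "((\<lambda>v. R v * (\<mu> * \<omega> v) powr - q) \<longlongrightarrow> 0) (at_right 0)"
proof (rule Lim_transform_eventually)
  show "((\<lambda>v. \<mu> powr - q * (R v * \<omega> v powr - q)) \<longlongrightarrow> 0) (at_right 0)"
    using tendsto_mult[OF tendsto_const lim] by simp
  show "\<forall>\<^sub>F v in at_right 0. \<mu> powr - q * (R v * \<omega> v powr - q) = R v * (\<mu> * \<omega> v) powr - q"
    using ev01 by eventually_elim (use \<omega> \<open>0 < \<mu>\<close> in \<open>simp add: powr_mult less_imp_le\<close>)
qed

text \<open>Along \<open>\<mu> * v\<close> the prescribed derivative tends to \<open>h 0\<close>, so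
  for \<open>0 < \<mu> < h 0\<close> such a line is crossed only upwards near \<open>0\<close>.
  Either some line stays below \<open>y\<close> and acts as the barrier of \<open>slope_h0\<close>,
  or \<open>y\<close> falls below all of them. When \<open>h 0 = 0\<close>, the upper bound
  \<open>slope_le\<close> already gives slope \<open>0\<close>.\<close>

lemma slope_dichotomy:
  assumes lim: "((\<lambda>v. R v * v powr - q) \<longlongrightarrow> 0) (at_right 0)"
  shows "((\<lambda>v. y v / v) \<longlongrightarrow> 0) (at_right 0) \<or> 0 < h 0 \<and> ((\<lambda>v. y v / v) \<longlongrightarrow> h 0) (at_right 0)"
proof (cases "h 0 = 0")
  case True
  then show ?thesis using slope_zero slope_le by auto
next
  case False
  then have h0: "0 < h 0" using h0_nonneg by simp
  have lim_mult: "((\<lambda>v. R v * (\<mu> * v) powr - q) \<longlongrightarrow> 0) (at_right 0)" if "0 < \<mu>" for \<mu>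
    by (rule scaled_limit[OF that lim]) simp
  show ?thesis
  proof (cases "\<exists>\<mu>>0. \<forall>\<^sub>F v in at_right 0. \<mu> * v \<le> y v")
    case True
    then obtain \<mu> where \<mu>: "0 < \<mu>" "\<forall>\<^sub>F v in at_right 0. \<mu> * v \<le> y v" by blast
    have "\<forall>\<^sub>F v in at_right 0. 0 < \<mu> * v \<and> \<mu> * v \<le> y v"
      using \<mu>(2) ev01 by eventually_elim (use \<mu>(1) in auto)
    from slope_h0[OF this lim_mult h0] show ?thesis using \<mu>(1) h0 by blast
  next
    case False
    have "\<forall>\<^sub>F v in at_right 0. y v / v \<le> e" if e: "0 < e" for e
    proof -
      define \<mu> where "\<mu> = min e (h 0 / 2)"
      have \<mu>: "0 < \<mu>" "\<mu> < h 0" "\<mu> \<le> e" using e h0 by (auto simp: \<mu>_def)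
      have "((\<lambda>v. h v - R v * (\<mu> * v) powr - q) \<longlongrightarrow> h 0 - 0) (at_right 0)"
        by (intro tendsto_diff h_tendsto lim_mult \<mu>)
      then have "\<forall>\<^sub>F v in at_right 0. \<mu> < h v - R v * (\<mu> * v) powr - q"
        using \<mu>(2) by (intro order_tendstoD) auto
      then have "\<forall>\<^sub>F v in at_right 0. y v = \<mu> * v \<longrightarrow> \<mu> < h v - R v * y v powr - q"
        by eventually_elim auto
      moreover have "\<forall>\<^sub>F v in at_right 0. ((\<lambda>v. \<mu> * v) has_real_derivative \<mu>) (at v)"
        by (intro always_eventually) (auto intro!: derivative_eq_intros)
      ultimately have "(\<forall>\<^sub>F v in at_right 0. y v < \<mu> * v) \<or> (\<forall>\<^sub>F v in at_right 0. \<mu> * v \<le> y v)"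
        by (intro eventually_less_or_ge[OF y_deriv])
      with False \<mu>(1) have "\<forall>\<^sub>F v in at_right 0. y v < \<mu> * v" by blast
      then show ?thesis using ev01
      proof eventually_elim
        case (elim v)
        then have "y v / v \<le> \<mu>" by (simp add: field_simps)
        then show ?case using \<mu>(3) by simp
      qed
    qed
    then show ?thesis using slope_zero by blast
  qed
qed

text \<open>Slope \<open>0\<close> of \<open>y\<close> alone does not control \<open>y / d\<close>
  when \<open>d\<close> is flat at \<open>0\<close> as well. The barrier is therefore
  \<open>\<mu> * d\<close>: its derivative tends to \<open>0\<close> while the equation along it
  prescribes nearly \<open>h 0 > 0\<close>, so crossings go upwards. Remaining above it would give
  slope \<open>h 0\<close> by \<open>slope_h0\<close>, against \<open>slope\<close>.\<close>

lemma ratio_tendsto_0: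
  assumes d: "\<And>v. 0 < v \<Longrightarrow> v < 1 \<Longrightarrow> (d has_real_derivative d' v) (at v) \<and> 0 < d v"
    and d': "(d' \<longlongrightarrow> 0) (at_right 0)"
    and Rd: "((\<lambda>v. R v * d v powr - q) \<longlongrightarrow> 0) (at_right 0)"
    and h0: "0 < h 0"
    and slope: "((\<lambda>v. y v / v) \<longlongrightarrow> 0) (at_right 0)"
  shows "((\<lambda>v. y v / d v) \<longlongrightarrow> 0) (at_right 0)"
proof (rule tendsto_0_le[where K = 1], rule tendstoI)
  fix e :: real assume "0 < e"
  define \<mu> where "\<mu> = e / 2"
  have \<mu>: "0 < \<mu>" "\<mu> < e" using \<open>0 < e\<close> by (auto simp: \<mu>_def)
  have lim_mult: "((\<lambda>v. R v * (\<mu> * d v) powr - q) \<longlongrightarrow> 0) (at_right 0)"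
    by (rule scaled_limit[OF \<mu>(1) Rd]) (use d in auto)
  have "((\<lambda>v. h v - R v * (\<mu> * d v) powr - q - \<mu> * d' v) \<longlongrightarrow> h 0 - 0 - \<mu> * 0) (at_right 0)"
    by (intro tendsto_intros h_tendsto lim_mult d')
  then have "\<forall>\<^sub>F v in at_right 0. 0 < h v - R v * (\<mu> * d v) powr - q - \<mu> * d' v"
    using h0 by (intro order_tendstoD) auto
  then have up: "\<forall>\<^sub>F v in at_right 0. y v = \<mu> * d v \<longrightarrow> \<mu> * d' v < h v - R v * y v powr - q"
    by eventually_elim auto
  have "\<forall>\<^sub>F v in at_right 0. ((\<lambda>v. \<mu> * d v) has_real_derivative \<mu> * d' v) (at v)"
    using ev01 by eventually_elim (use d in \<open>auto intro!: DERIV_cmult\<close>)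
  from eventually_less_or_ge[OF y_deriv this up]
  have "\<forall>\<^sub>F v in at_right 0. y v < \<mu> * d v"
  proof
    assume "\<forall>\<^sub>F v in at_right 0. \<mu> * d v \<le> y v"
    then have "\<forall>\<^sub>F v in at_right 0. 0 < \<mu> * d v \<and> \<mu> * d v \<le> y v"
      using ev01 by eventually_elim (use d \<mu> in auto)
    from slope_h0[OF this lim_mult h0] have "h 0 = 0"
      using slope tendsto_unique[OF trivial_limit_at_right_real] by blast
    then show ?thesis using h0 by simp
  qed
  then show "\<forall>\<^sub>F v in at_right 0. dist (y v / d v) 0 < e"
    using ev01
  proof eventually_elim
    case (elim v)
    then have "0 < d v" "0 < y v" using d y by auto
    moreover have "\<mu> * d v < e * d v" using \<mu> \<open>0 < d v\<close> by simp
    then have "y v < e * d v" using elim(1) by linarith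
    ultimately show ?case by (simp add: divide_less_eq)
  qed
qed auto

end

subsection \<open>Waves and profiles\<close>

lemma einterval_sandwich: "s \<in> einterval \<alpha> \<beta> \<Longrightarrow> t \<in> einterval \<alpha> \<beta> \<Longrightarrow> {s..t} \<subseteq> einterval \<alpha> \<beta>"
  by (auto simp: einterval_def intro: less_le_trans le_less_trans)
    (meson ereal_less_eq(3) less_le_trans le_less_trans)+

lemma DERIV_imp_continuous_on:
  "(\<And>x. x \<in> S \<Longrightarrow> (f has_real_derivative f' x) (at x)) \<Longrightarrow> continuous_on S f"
  by (meson DERIV_isCont continuous_at_imp_continuous_on)

lemma eventually_einterval_at_left:
  fixes \<alpha> \<beta> :: ereal
  assumes "\<alpha> < \<beta>"
  shows "\<forall>\<^sub>F x in at_left \<beta>. real_of_ereal x \<in> einterval \<alpha> \<beta> \<and> ereal (real_of_ereal x) = x"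
  by (rule eventually_at_leftI[OF _ assms]) (auto simp: einterval_def ereal_real)

lemma eventually_einterval_at_right:
  fixes \<alpha> \<beta> :: ereal
  assumes "\<alpha> < \<beta>"
  shows "\<forall>\<^sub>F x in at_right \<alpha>. real_of_ereal x \<in> einterval \<alpha> \<beta> \<and> ereal (real_of_ereal x) = x"
  by (rule eventually_at_rightI[OF _ assms]) (auto simp: einterval_def ereal_real)

lemma eventually_at_left_obtain:
  fixes \<alpha> \<beta> :: ereal
  assumes "\<alpha> < \<beta>" and "\<forall>\<^sub>F x in at_left \<beta>. P (real_of_ereal x)"
  obtains t where "t \<in> einterval \<alpha> \<beta>" "P t"
proof -
  obtain b where b: "b < \<beta>" "\<And>z. b < z \<Longrightarrow> z < \<beta> \<Longrightarrow> P (real_of_ereal z)"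
    using assms(2) eventually_at_left[OF assms(1)] by auto
  obtain t where t: "max \<alpha> b < ereal t" "ereal t < \<beta>"
    using ereal_dense2[of "max \<alpha> b" \<beta>] b(1) assms(1) by auto
  show thesis using b(2)[of "ereal t"] t by (intro that[of t]) (auto simp: einterval_def)
qed

lemma eventually_at_right_obtain:
  fixes \<alpha> \<beta> :: ereal
  assumes "\<alpha> < a" and "\<forall>\<^sub>F x in at_right \<alpha>. P (real_of_ereal x)"
  obtains t where "t \<in> einterval \<alpha> a" "P t"
proof -
  obtain b where b: "\<alpha> < b" "\<And>z. \<alpha> < z \<Longrightarrow> z < b \<Longrightarrow> P (real_of_ereal z)"
    using assms(2) eventually_at_right[OF assms(1)] by auto
  obtain t where t: "\<alpha> < ereal t" "ereal t < min a b"
    using ereal_dense2[of \<alpha> "min a b"] b(1) assms(1) by auto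
  show thesis using b(2)[of "ereal t"] t by (intro that[of t]) (auto simp: einterval_def)
qed

text \<open>Below, \<open>f\<close> tends to \<open>hi\<close> at \<open>\<alpha>\<close> and to \<open>lo\<close> at \<open>\<beta>\<close>.\<close>

locale decreasing_diffeo =
  fixes f f' :: "real \<Rightarrow> real" and \<alpha> \<beta> :: ereal
  assumes ne: "\<alpha> < \<beta>"
    and der: "\<And>t. t \<in> einterval \<alpha> \<beta> \<Longrightarrow> (f has_real_derivative f' t) (at t)"
    and neg: "\<And>t. t \<in> einterval \<alpha> \<beta> \<Longrightarrow> f' t < 0"
begin

abbreviation "I \<equiv> einterval \<alpha> \<beta>"

text \<open>Infimum and supremum are taken in \<open>ereal\<close> so that the image can be
  described without any hypothesis on limits. For a wave they turn out to be \<open>0\<close> and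
  \<open>1\<close>; for the time function in \<open>profile_wave\<close> they may be
  infinite.\<close>

definition "lo = (INF t\<in>I. ereal (f t))"
definition "hi = (SUP t\<in>I. ereal (f t))"
definition "g = the_inv_into I f"

lemma decreasing: "s \<in> I \<Longrightarrow> t \<in> I \<Longrightarrow> s < t \<Longrightarrow> f t < f s"
  using DERIV_neg_imp_decreasing[of s t f] der neg einterval_sandwich[of s \<alpha> \<beta> t]
  by (metis atLeastAtMost_iff subsetD)

lemma less_iff: "s \<in> I \<Longrightarrow> t \<in> I \<Longrightarrow> f s < f t \<longleftrightarrow> t < s"
  using decreasing by (metis linorder_neqE_linordered_idom order_less_asym)

lemma inj: "inj_on f I"
  using decreasing by (metis inj_onI linorder_neqE_linordered_idom order_less_irrefl)

lemma right_of:
  assumes "t \<in> I"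
  shows "\<exists>s\<in>I. t < s"
proof -
  obtain s where s: "ereal t < ereal s" "ereal s < \<beta>"
    using ereal_dense2[of "ereal t" \<beta>] assms by (auto simp: einterval_def)
  then have "\<alpha> < ereal s" using assms less_trans[of \<alpha> "ereal t" "ereal s"] by (auto simp: einterval_def)
  then show ?thesis using s by (auto simp: einterval_def)
qed

lemma left_of:
  assumes "t \<in> I"
  shows "\<exists>s\<in>I. s < t"
proof -
  obtain s where s: "\<alpha> < ereal s" "ereal s < ereal t"
    using ereal_dense2[of \<alpha> "ereal t"] assms by (auto simp: einterval_def)
  then have "ereal s < \<beta>" using assms less_trans[of "ereal s" "ereal t" \<beta>] by (auto simp: einterval_def)
  then show ?thesis using s by (auto simp: einterval_def)
qed

lemma nonempty: "\<exists>t. t \<in> I"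
  using ereal_dense2[OF ne] by (auto simp: einterval_def)

text \<open>The interval is open, so there are larger and smaller values next to each
  \<open>f t\<close> and neither bound is attained; the values in between come from the intermediate
  value theorem.\<close>

lemma image: "f ` I = einterval lo hi"
proof (intro subset_antisym subsetI)
  fix v assume "v \<in> f ` I"
  then obtain t where t: "t \<in> I" "v = f t" by blast
  obtain s s' where s: "s \<in> I" "s < t" "s' \<in> I" "t < s'" using left_of right_of t by metis
  have "lo \<le> ereal (f s')" "ereal (f s) \<le> hi"
    unfolding lo_def hi_def using s by (auto intro: INF_lower SUP_upper)
  moreover have "ereal (f s') < ereal (f t)" "ereal (f t) < ereal (f s)"
    using s t decreasing by auto
  ultimately have "lo < ereal (f t)" "ereal (f t) < hi" by order+
  then show "v \<in> einterval lo hi" by (simp add: t einterval_def)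
next
  fix v assume "v \<in> einterval lo hi"
  then obtain s t where s: "s \<in> I" "f s < v" and t: "t \<in> I" "v < f t"
    by (auto simp: einterval_def lo_def hi_def INF_less_iff less_SUP_iff)
  then have "t < s" using less_iff[of s t] by simp
  have sub: "{t..s} \<subseteq> I" using einterval_sandwich s t by blast
  then have "continuous_on {t..s} f" using der by (intro DERIV_imp_continuous_on[where f' = f']) auto
  then have "\<exists>x\<ge>t. x \<le> s \<and> f x = v" using s t \<open>t < s\<close> by (intro IVT2') auto
  then show "v \<in> f ` I" using sub by auto
qed

lemma g_f: "t \<in> I \<Longrightarrow> g (f t) = t"
  unfolding g_def by (rule the_inv_into_f_f[OF inj])

lemma f_g: "v \<in> einterval lo hi \<Longrightarrow> f (g v) = v"
  unfolding g_def using f_the_inv_into_f[OF inj] image by simp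

lemma g_in: "v \<in> einterval lo hi \<Longrightarrow> g v \<in> I"
  using image g_f by (metis imageE)

lemma f_in: "t \<in> I \<Longrightarrow> f t \<in> einterval lo hi"
  using image by blast

lemma lo_less_hi: "lo < hi"
  using nonempty f_in by (force simp: einterval_def)

lemma g_deriv:
  assumes "v \<in> einterval lo hi"
  shows "(g has_real_derivative inverse (f' (g v))) (at v)"
proof -
  let ?t = "g v"
  have t: "?t \<in> I" by (rule g_in[OF assms])
  have "(g has_derivative (\<lambda>x. x * inverse (f' ?t))) (at (f ?t))"
  proof (rule has_derivative_inverse_strong[where S = I and f = f and x = ?t and f' = "\<lambda>x. x * f' ?t"])
    show "continuous_on I f" using der by (rule DERIV_imp_continuous_on)
    show "(f has_derivative (\<lambda>x. x * f' ?t)) (at ?t)"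
      using der[OF t] by (simp add: has_field_derivative_def mult_commute_abs)
    show "(\<lambda>x. x * f' ?t) \<circ> (\<lambda>x. x * inverse (f' ?t)) = id"
      using neg[OF t] by auto
  qed (use t g_f in auto)
  then show ?thesis
    using f_g[OF assms] by (simp add: has_field_derivative_def mult_commute_abs)
qed

lemma less_f_g: "v \<in> einterval lo hi \<Longrightarrow> t \<in> I \<Longrightarrow> v < f t \<Longrightarrow> t < g v"
  using less_iff[of "g v" t] f_g g_in by metis

lemma f_less_g: "v \<in> einterval lo hi \<Longrightarrow> t \<in> I \<Longrightarrow> f t < v \<Longrightarrow> g v < t"
  using less_iff[of t "g v"] f_g g_in by metis

text \<open>The target is \<open>at_right lo\<close> and not a neighbourhood filter: the values
  approach \<open>lo\<close> strictly from above, which permits composition with one-sided limits of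
  profiles.\<close>

lemma filterlim_f_at_left: "filterlim (\<lambda>x. ereal (f (real_of_ereal x))) (at_right lo) (at_left \<beta>)"
proof (subst filterlim_iff, intro allI impI)
  fix P assume "eventually P (at_right lo)"
  then obtain b where b: "lo < b" "\<And>z. lo < z \<Longrightarrow> z < b \<Longrightarrow> P z"
    using eventually_at_right[OF lo_less_hi] by auto
  then obtain t where t: "t \<in> I" "ereal (f t) < b"
    unfolding lo_def by (auto simp: INF_less_iff)
  have "\<forall>\<^sub>F x in at_left \<beta>. ereal t < x"
    using t by (intro eventually_at_leftI[of "ereal t"]) (auto simp: einterval_def)
  then show "\<forall>\<^sub>F x in at_left \<beta>. P (ereal (f (real_of_ereal x)))"
    using eventually_einterval_at_left[OF ne]
  proof eventually_elim
    case (elim x)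
    then have "t < real_of_ereal x" by (metis ereal_less(1) less_ereal.simps(1))
    then have "f (real_of_ereal x) < f t" using decreasing t elim by blast
    then have "ereal (f (real_of_ereal x)) < b" 
      using t less_trans[of "ereal (f (real_of_ereal x))" "ereal (f t)" b] by simp
    then show ?case using f_in[of "real_of_ereal x"] elim
      by (intro b) (auto simp: einterval_def)
  qed
qed

lemma filterlim_g_at_right: "filterlim (\<lambda>x. ereal (g (real_of_ereal x))) (at_left \<beta>) (at_right lo)"
proof (subst filterlim_iff, intro allI impI)
  fix P assume "eventually P (at_left \<beta>)"
  then obtain b where b: "b < \<beta>" "\<And>z. b < z \<Longrightarrow> z < \<beta> \<Longrightarrow> P z"
    using eventually_at_left[OF ne] by auto
  obtain t where t: "max \<alpha> b < ereal t" "ereal t < \<beta>"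
    using ereal_dense2[of "max \<alpha> b" \<beta>] b(1) ne by auto
  then have tI: "t \<in> I" by (auto simp: einterval_def)
  have "\<forall>\<^sub>F x in at_right lo. x < ereal (f t)"
    using f_in[OF tI] by (intro eventually_at_rightI[of _ "ereal (f t)"]) (auto simp: einterval_def)
  then show "\<forall>\<^sub>F x in at_right lo. P (ereal (g (real_of_ereal x)))"
    using eventually_einterval_at_right[OF lo_less_hi]
  proof eventually_elim
    case (elim x)
    then have "real_of_ereal x < f t" by (metis less_ereal.simps(1))
    then have "t < g (real_of_ereal x)" using less_f_g tI elim by blast
    then have "b < ereal (g (real_of_ereal x))"
      using t less_trans[of b "ereal t" "ereal (g (real_of_ereal x))"] by simp
    then show ?case using g_in[of "real_of_ereal x"] elim
      by (intro b) (auto simp: einterval_def)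
  qed
qed

lemma filterlim_g_at_left: "filterlim (\<lambda>x. ereal (g (real_of_ereal x))) (at_right \<alpha>) (at_left hi)"
proof (subst filterlim_iff, intro allI impI)
  fix P assume "eventually P (at_right \<alpha>)"
  then obtain b where b: "\<alpha> < b" "\<And>z. \<alpha> < z \<Longrightarrow> z < b \<Longrightarrow> P z"
    using eventually_at_right[OF ne] by auto
  obtain t where t: "\<alpha> < ereal t" "ereal t < min \<beta> b"
    using ereal_dense2[of \<alpha> "min \<beta> b"] b(1) ne by auto
  then have tI: "t \<in> I" by (auto simp: einterval_def)
  have "\<forall>\<^sub>F x in at_left hi. ereal (f t) < x"
    using f_in[OF tI] by (intro eventually_at_leftI[of "ereal (f t)"]) (auto simp: einterval_def)
  then show "\<forall>\<^sub>F x in at_left hi. P (ereal (g (real_of_ereal x)))"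
    using eventually_einterval_at_left[OF lo_less_hi]
  proof eventually_elim
    case (elim x)
    then have "f t < real_of_ereal x" by (metis less_ereal.simps(1))
    then have "g (real_of_ereal x) < t" using f_less_g tI elim by blast
    then have "ereal (g (real_of_ereal x)) < b"
      using t less_trans[of "ereal (g (real_of_ereal x))" "ereal t" b] by simp
    then show ?case using g_in[of "real_of_ereal x"] elim
      by (intro b) (auto simp: einterval_def)
  qed
qed

end

lemma C1_differentiable_on_deriv:
  fixes f :: "real \<Rightarrow> real"
  assumes "f C1_differentiable_on S" "x \<in> S"
  shows "(f has_real_derivative deriv f x) (at x)"
  using assms unfolding C1_differentiable_on_def has_real_derivative_iff_has_vector_derivative[symmetric]
  by (metis DERIV_imp_deriv)

lemma C1_differentiable_onI:
  fixes f :: "real \<Rightarrow> real"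
  assumes "\<And>x. x \<in> S \<Longrightarrow> (f has_real_derivative D x) (at x)" "continuous_on S D"
  shows "f C1_differentiable_on S"
  using assms unfolding C1_differentiable_on_def has_real_derivative_iff_has_vector_derivative[symmetric]
  by blast

lemma neg_flux_eq:
  fixes p a :: real
  assumes "a < 0"
  shows "\<bar>a\<bar> powr (p - 2) * a = - ((- a) powr (p - 1))"
proof -
  have "(- a) powr (p - 1) = (- a) powr ((p - 2) + 1)" by simp
  also have "\<dots> = (- a) powr (p - 2) * (- a)"
    using assms by (subst powr_add) simp
  finally show ?thesis using assms by simp
qed

section \<open>The correspondence between waves and profiles\<close>

locale standing =
  fixes p :: real and f g \<rho> d :: "real \<Rightarrow> real"
  assumes sa: "standing_assumptions p f g \<rho> d"
begin

definition "q = 1 / (p - 1)"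
definition "R v = \<rho> v * d v powr q"
definition "h c v = c * g v - f v"

lemma p: "1 < p" and f: "continuous_on {0..1} f" and g: "continuous_on {0..1} g"
  and \<rho>: "continuous_on {0..1} \<rho>" and d: "d C1_differentiable_on {0<..<1}"
  and \<rho>_pos: "\<And>v. 0 < v \<Longrightarrow> v < 1 \<Longrightarrow> 0 < \<rho> v" and \<rho>0: "\<rho> 0 = 0"
  and g0: "0 < g 0" and int_g: "\<And>v. 0 < v \<Longrightarrow> v \<le> 1 \<Longrightarrow> 0 < integral {0..v} g"
  and d_pos: "\<And>v. 0 < v \<Longrightarrow> v < 1 \<Longrightarrow> 0 < d v"
  and Rint: "set_integrable lborel {0<..<1} R"
  using sa unfolding standing_assumptions_def R_def[abs_def] q_def by auto

lemma q: "0 < q" using p by (simp add: q_def)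

lemma h: "continuous_on {0..1} (h c)"
  unfolding h_def[abs_def] by (intro continuous_intros f g)

lemma d_deriv: "0 < v \<Longrightarrow> v < 1 \<Longrightarrow> (d has_real_derivative deriv d v) (at v)"
  using C1_differentiable_on_deriv[OF d] by simp

lemma d_cont: "continuous_on {0<..<1} d"
  by (rule DERIV_imp_continuous_on[where f' = "deriv d"]) (use d_deriv in auto)

lemma R_pos: "0 < v \<Longrightarrow> v < 1 \<Longrightarrow> 0 < R v"
  using \<rho>_pos[of v] d_pos[of v] by (simp add: R_def)

lemma R_cont: "continuous_on {0<..<1} R"
  unfolding R_def[abs_def] using d_pos
  by (intro continuous_intros d_cont continuous_on_subset[OF \<rho>]) force+

lemma R_integrable: "R integrable_on {0..1}"
proof -
  have "R integrable_on {0<..<1}"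
    using set_borel_integral_eq_integral(1)[OF Rint] .
  then show ?thesis by (simp add: integrable_on_open_interval_real)
qed

context
  fixes c :: real and \<alpha> \<beta> :: ereal and u :: "real \<Rightarrow> real"
  assumes tw: "travelling_wave p f g \<rho> d c \<alpha> \<beta> u"
begin

abbreviation (input) "fl \<equiv> flux p d u"

lemma
  shows wave_ne: "\<alpha> < \<beta>"
    and u_deriv: "\<And>t. t \<in> einterval \<alpha> \<beta> \<Longrightarrow> (u has_real_derivative deriv u t) (at t)"
    and flux_deriv: "\<And>t. t \<in> einterval \<alpha> \<beta> \<Longrightarrow> (fl has_real_derivative deriv fl t) (at t)"
    and u01: "\<And>t. t \<in> einterval \<alpha> \<beta> \<Longrightarrow> 0 < u t \<and> u t < 1"
    and ode: "\<And>t. t \<in> einterval \<alpha> \<beta> \<Longrightarrow> deriv fl t + h c (u t) * deriv u t + \<rho> (u t) = 0"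
    and u_left: "((\<lambda>x. u (real_of_ereal x)) \<longlongrightarrow> 1) (at_right \<alpha>)"
    and u_right: "((\<lambda>x. u (real_of_ereal x)) \<longlongrightarrow> 0) (at_left \<beta>)"
    and flux_left: "((\<lambda>x. fl (real_of_ereal x)) \<longlongrightarrow> 0) (at_right \<alpha>)"
    and flux_right: "((\<lambda>x. fl (real_of_ereal x)) \<longlongrightarrow> 0) (at_left \<beta>)"
  using tw C1_differentiable_on_deriv unfolding travelling_wave_def h_def comp_def by blast+

text \<open>At a critical point the flux vanishes with slope \<open>- \<rho> (u x) < 0\<close>, so it is positive to the
  left.\<close>

lemma less_left_of_nonneg_deriv:
  assumes x: "x \<in> einterval \<alpha> \<beta>" and nonneg: "0 \<le> deriv u x"
  obtains e where "0 < e" "\<And>h. 0 < h \<Longrightarrow> h < e \<Longrightarrow> u (x - h) < u x"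
proof (cases "deriv u x = 0")
  case False
  then show thesis using DERIV_pos_inc_left[OF u_deriv[OF x]] nonneg that by auto
next
  case True
  then have "deriv fl x < 0" using ode[OF x] \<rho>_pos u01[OF x] by fastforce
  then obtain e where e: "0 < e" "\<And>h. 0 < h \<Longrightarrow> h < e \<Longrightarrow> fl x < fl (x - h)"
    using DERIV_neg_dec_left[OF flux_deriv[OF x]] by auto
  have fl0: "fl x = 0" using True by (simp add: flux_def)
  have "\<alpha> < ereal x" "ereal x < \<beta>" using x by (auto simp: einterval_def)
  then obtain s where s: "\<alpha> < ereal s" "s < x" using ereal_dense2[of \<alpha> "ereal x"] by auto
  then have sI: "s \<in> einterval \<alpha> \<beta>"
    using \<open>ereal x < \<beta>\<close> less_trans[of "ereal s" "ereal x" \<beta>] by (auto simp: einterval_def)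
  define e' where "e' = min e (x - s)"
  have I: "z \<in> einterval \<alpha> \<beta>" if "s \<le> z" "z \<le> x" for z
    using einterval_sandwich[OF sI x] that by auto
  have pos: "0 < deriv u (x - h)" if h: "0 < h" "h < e'" for h
  proof -
    have "0 < d (u (x - h)) * \<bar>deriv u (x - h)\<bar> powr (p - 2) * deriv u (x - h)"
      using e(2)[of h] h fl0 by (auto simp: e'_def flux_def)
    moreover have "0 \<le> d (u (x - h)) * \<bar>deriv u (x - h)\<bar> powr (p - 2)"
      using d_pos[of "u (x - h)"] u01[OF I[of "x - h"]] h by (auto simp: e'_def)
    ultimately show ?thesis by (simp add: zero_less_mult_iff)
  qed
  have "u (x - h) < u x" if h: "0 < h" "h < e'" for h
  proof (rule DERIV_pos_imp_increasing_open[where f = u])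
    show "x - h < x" using h by simp
    show "\<exists>y. (u has_real_derivative y) (at z) \<and> 0 < y" if "x - h < z" "z < x" for z
      using u_deriv[OF I[of z]] pos[of "x - z"] that h by (auto simp: e'_def)
    show "continuous_on {x - h..x} u"
      by (rule DERIV_imp_continuous_on[where f' = "deriv u"], rule u_deriv, rule I)
        (use h in \<open>auto simp: e'_def\<close>)
  qed
  moreover have "0 < e'" using e s by (simp add: e'_def)
  ultimately show thesis using that by blast
qed

text \<open>The limit \<open>1\<close> at \<open>\<alpha>\<close> supplies a point \<open>s\<close>
  left of \<open>t\<close> with \<open>u t < u s\<close>, so the minimum of \<open>u\<close> on
  \<open>{s..t}\<close> is attained at some \<open>x > s\<close>. There the derivative is
  nonnegative, by assumption if \<open>x = t\<close> and as an interior minimum otherwise, and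
  \<open>u\<close> takes smaller values just to the left of \<open>x\<close>.\<close>

lemma deriv_neg:
  assumes t: "t \<in> einterval \<alpha> \<beta>"
  shows "deriv u t < 0"
proof (rule ccontr)
  assume "\<not> deriv u t < 0"
  then have nonneg: "0 \<le> deriv u t" by simp
  have "\<forall>\<^sub>F x in at_right \<alpha>. u t < u (real_of_ereal x)"
    using order_tendstoD(1)[OF u_left] u01[OF t] by auto
  moreover have "\<alpha> < ereal t" using t by (auto simp: einterval_def)
  ultimately obtain s where s: "s \<in> einterval \<alpha> (ereal t)" "u t < u s"
    by (elim eventually_at_right_obtain)
  then have st: "s < t" by (auto simp: einterval_def)
  have sI: "s \<in> einterval \<alpha> \<beta>"
    using s t less_trans[of "ereal s" "ereal t" \<beta>] by (auto simp: einterval_def)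
  have I: "z \<in> einterval \<alpha> \<beta>" if "s \<le> z" "z \<le> t" for z
    using einterval_sandwich[OF sI t] that by auto
  have "continuous_on {s..t} u"
    by (rule DERIV_imp_continuous_on[where f' = "deriv u"], rule u_deriv, rule I) auto
  then obtain x where x: "x \<in> {s..t}" and min: "\<And>z. z \<in> {s..t} \<Longrightarrow> u x \<le> u z"
    using continuous_attains_inf[of "{s..t}" u] st by auto
  have sx: "s < x" using min[of t] s x st by (cases "x = s") auto
  have "0 \<le> deriv u x"
  proof (cases "x = t")
    case True
    then show ?thesis using nonneg by simp
  next
    case False
    have "deriv u x = 0"
    proof (rule DERIV_local_min[OF u_deriv[OF I]])
      show "0 < min (x - s) (t - x)" using sx x False by auto
    qed (use x min in \<open>auto simp: abs_less_iff\<close>)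
    then show ?thesis by simp
  qed
  then obtain e where e: "0 < e" "\<And>h. 0 < h \<Longrightarrow> h < e \<Longrightarrow> u (x - h) < u x"
    using less_left_of_nonneg_deriv[OF I[of x]] x by auto
  define k where "k = min (e / 2) (x - s)"
  have "0 < k" "k < e" "k \<le> x - s" using e sx by (auto simp: k_def)
  then show False using e(2)[of k] min[of "x - k"] x by auto
qed

text \<open>The chain rule through the inverse of \<open>u\<close> amounts to dividing the wave
  equation by \<open>u'\<close>, and the limits of the flux at \<open>\<beta>\<close> and
  \<open>\<alpha>\<close> become the boundary values of \<open>y\<close> at \<open>0\<close> and
  \<open>1\<close>. The last conclusion later turns limits of \<open>y v / d v\<close> at
  \<open>0\<close> into limits of \<open>deriv u\<close> at \<open>\<beta>\<close>.\<close>

lemma wave_profile: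
  obtains y where "profile q (h c) R y"
    "\<And>t. t \<in> einterval \<alpha> \<beta> \<Longrightarrow> deriv u t = - ((y (u t) / d (u t)) powr q)"
    "filterlim (\<lambda>x. u (real_of_ereal x)) (at_right 0) (at_left \<beta>)"
proof -
  interpret U: decreasing_diffeo u "deriv u" \<alpha> \<beta>
    by unfold_locales (use wave_ne u_deriv deriv_neg in auto)
  have lo: "U.lo = ereal 0"
    unfolding U.lo_def
  proof (rule INF_eqI)
    show "ereal 0 \<le> ereal (u t)" if "t \<in> einterval \<alpha> \<beta>" for t
      using u01[OF that] by simp
    fix b assume b: "\<And>t. t \<in> einterval \<alpha> \<beta> \<Longrightarrow> b \<le> ereal (u t)"
    show "b \<le> ereal 0"
    proof (rule ccontr)
      assume "\<not> b \<le> ereal 0"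
      then have "ereal 0 < b" by (simp only: not_le)
      then obtain e where e: "0 < e" "ereal e < b"
        using ereal_dense2[of "ereal 0" b] by auto
      have "\<forall>\<^sub>F x in at_left \<beta>. u (real_of_ereal x) < e"
        using order_tendstoD(2)[OF u_right] e by auto
      then obtain t where "t \<in> einterval \<alpha> \<beta>" "u t < e"
        by (rule eventually_at_left_obtain[OF wave_ne])
      then have "b \<le> ereal (u t)" "ereal (u t) < ereal e" using b by auto
      then show False using e(2) by order
    qed
  qed
  have hi: "U.hi = ereal 1"
    unfolding U.hi_def
  proof (rule SUP_eqI)
    show "ereal (u t) \<le> ereal 1" if "t \<in> einterval \<alpha> \<beta>" for t
      using u01[OF that] by simp
    fix b assume b: "\<And>t. t \<in> einterval \<alpha> \<beta> \<Longrightarrow> ereal (u t) \<le> b"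
    show "ereal 1 \<le> b"
    proof (rule ccontr)
      assume "\<not> ereal 1 \<le> b"
      then have "b < ereal 1" by (simp only: not_le)
      then obtain e where e: "e < 1" "b < ereal e"
        using ereal_dense2[of b "ereal 1"] by auto
      have "\<forall>\<^sub>F x in at_right \<alpha>. e < u (real_of_ereal x)"
        using order_tendstoD(1)[OF u_left] e by auto
      then obtain t where "t \<in> einterval \<alpha> \<beta>" "e < u t"
        by (rule eventually_at_right_obtain[OF wave_ne])
      then have "ereal (u t) \<le> b" "ereal e < ereal (u t)" using b by auto
      then show False using e(2) by order
    qed
  qed
  define y where "y v = - fl (U.g v)" for v
  have y_eq: "y (u t) = d (u t) * (- deriv u t) powr (p - 1)" if t: "t \<in> einterval \<alpha> \<beta>" for t
    using neg_flux_eq[OF deriv_neg[OF t], of p] U.g_f[OF t] by (simp add: y_def flux_def mult.assoc)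
  have u'_eq: "deriv u t = - ((y (u t) / d (u t)) powr q)" if t: "t \<in> einterval \<alpha> \<beta>" for t
  proof -
    have "y (u t) / d (u t) = (- deriv u t) powr (p - 1)"
      using y_eq[OF t] d_pos[of "u t"] u01[OF t] by simp
    moreover have "((- deriv u t) powr (p - 1)) powr q = - deriv u t"
      using deriv_neg[OF t] p by (simp add: powr_powr q_def)
    ultimately show ?thesis by simp
  qed
  have "profile q (h c) R y"
    unfolding profile_def
  proof (intro conjI ballI)
    fix v :: real assume "v \<in> {0<..<1}"
    then have v: "v \<in> einterval U.lo U.hi" "0 < v" "v < 1" by (auto simp: lo hi einterval_def)
    let ?t = "U.g v"
    have t: "?t \<in> einterval \<alpha> \<beta>" "u ?t = v" using U.g_in U.f_g v by auto
    have neg: "deriv u ?t < 0" by (rule deriv_neg[OF t(1)])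
    show yv: "0 < y v" using y_eq[OF t(1)] d_pos[of v] neg v t by simp
    have "((\<lambda>v. - fl (U.g v)) has_real_derivative - (deriv fl ?t * inverse (deriv u ?t))) (at v)"
      by (intro DERIV_minus DERIV_chain2[OF flux_deriv[OF t(1)] U.g_deriv[OF v(1)]])
    moreover have "- (deriv fl ?t * inverse (deriv u ?t)) = h c v + \<rho> v / deriv u ?t"
    proof -
      have "deriv fl ?t = - (h c v * deriv u ?t + \<rho> v)" using ode[OF t(1)] t(2) by simp
      then show ?thesis using neg by (simp add: field_simps)
    qed
    \<comment> \<open>Substituting \<open>u' = - (y / d) powr q\<close> moves
      \<open>d powr q\<close> into the numerator, which is the origin of that factor in
      \<open>R\<close>.\<close>
    moreover have "\<rho> v / deriv u ?t = - (R v * y v powr - q)"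
    proof -
      have "deriv u ?t = - (y v powr q / d v powr q)"
        using u'_eq[OF t(1)] t(2) yv d_pos[of v] v by (simp add: powr_divide)
      then show ?thesis by (simp add: R_def powr_minus divide_inverse mult_ac)
    qed
    ultimately show "(y has_real_derivative h c v - R v * y v powr - q) (at v)"
      by (simp add: y_def[abs_def])
  next
    have "((\<lambda>x. fl (real_of_ereal (ereal (U.g (real_of_ereal x))))) \<longlongrightarrow> 0) (at_right (ereal 0))"
      using filterlim_compose[OF flux_right U.filterlim_g_at_right] by (simp add: lo)
    then have "(((\<lambda>v. fl (U.g v)) \<circ> real_of_ereal) \<longlongrightarrow> 0) (at_right (ereal 0))"
      by (simp add: comp_def)
    then have "((\<lambda>v. fl (U.g v)) \<longlongrightarrow> 0) (at_right 0)"
      by (simp only: ereal_tendsto_simps1)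
    from tendsto_minus[OF this] show "(y \<longlongrightarrow> 0) (at_right 0)" by (simp add: y_def[abs_def])
  next
    have "((\<lambda>x. fl (real_of_ereal (ereal (U.g (real_of_ereal x))))) \<longlongrightarrow> 0) (at_left (ereal 1))"
      using filterlim_compose[OF flux_left U.filterlim_g_at_left] by (simp add: hi)
    then have "(((\<lambda>v. fl (U.g v)) \<circ> real_of_ereal) \<longlongrightarrow> 0) (at_left (ereal 1))"
      by (simp add: comp_def)
    then have "((\<lambda>v. fl (U.g v)) \<longlongrightarrow> 0) (at_left 1)"
      by (simp only: ereal_tendsto_simps1)
    from tendsto_minus[OF this] show "(y \<longlongrightarrow> 0) (at_left 1)" by (simp add: y_def[abs_def])
  qed
  moreover have "filterlim (\<lambda>x. u (real_of_ereal x)) (at_right 0) (at_left \<beta>)"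
  proof -
    have "filterlim real_of_ereal (at_right 0) (at_right (ereal 0))"
      unfolding at_right_ereal filterlim_filtermap by (simp add: filterlim_ident)
    from filterlim_compose[OF this U.filterlim_f_at_left[unfolded lo]] show ?thesis by simp
  qed
  ultimately show thesis using u'_eq that by blast
qed

end

text \<open>Separation of variables in \<open>u' = - (y / d) powr q\<close>: \<open>T\<close> is the
  time as a function of the value, and \<open>u\<close> is its inverse. As \<open>T\<close>
  decreases, the value \<open>1\<close> belongs to the left end \<open>T.lo\<close> of the time
  interval and \<open>0\<close> to the right end \<open>T.hi\<close>.\<close>

lemma profile_wave:
  assumes prof: "profile q (h c) R y"
  shows "\<exists>\<alpha> \<beta> u. travelling_wave p f g \<rho> d c \<alpha> \<beta> u"
proof -
  note y = profileD[OF prof]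
  have y_cont: "continuous_on {0<..<1} y"
    by (rule DERIV_imp_continuous_on, rule y(2)) auto
  define s where "s v = (d v / y v) powr q" for v
  have s_pos: "0 < s v" if "0 < v" "v < 1" for v
    using y(1)[OF that] d_pos[OF that] by (simp add: s_def)
  have s_cont: "continuous_on {0<..<1} s"
    unfolding s_def[abs_def] using y(1) d_pos
    by (intro continuous_intros d_cont y_cont) (force simp: less_imp_neq[symmetric])+
  have E01: "einterval 0 1 = {0<..<1::real}"
    by (simp add: zero_ereal_def one_ereal_def)
  \<comment> \<open>An antiderivative on the open interval suffices: \<open>s\<close> need not be
    integrable up to \<open>0\<close> or \<open>1\<close>, and divergence there corresponds to an
    infinite endpoint of the wave.\<close>
  have "\<exists>T. \<forall>x::real. (0::ereal) < ereal x \<longrightarrow> ereal x < 1 \<longrightarrow> (T has_vector_derivative - s x) (at x)"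
  proof (rule einterval_antiderivative)
    fix x :: real assume "(0::ereal) < ereal x" "ereal x < 1"
    then have "isCont s x" using s_cont by (simp add: continuous_on_eq_continuous_at)
    then show "isCont (\<lambda>x. - s x) x" by simp
  qed simp
  then obtain T where T: "\<And>v. 0 < v \<Longrightarrow> v < 1 \<Longrightarrow> (T has_real_derivative - s v) (at v)"
    by (auto simp: has_real_derivative_iff_has_vector_derivative)
  interpret T: decreasing_diffeo T "\<lambda>v. - s v" 0 1
    by unfold_locales (use T s_pos in \<open>auto simp: E01\<close>)
  define u where "u = T.g"
  have u01: "0 < u t" "u t < 1" if "t \<in> einterval T.lo T.hi" for t
    using T.g_in[OF that] by (auto simp: u_def E01)
  define u' where "u' t = - ((y (u t) / d (u t)) powr q)" for t
  have du: "(u has_real_derivative u' t) (at t)" if t: "t \<in> einterval T.lo T.hi" for t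
  proof -
    have "inverse (- s (u t)) = u' t"
      using y(1)[OF u01[OF t]] d_pos[OF u01[OF t]]
      by (simp add: s_def u'_def powr_divide)
    then show ?thesis using T.g_deriv[OF t] by (simp add: u_def)
  qed
  have u'_neg: "u' t < 0" if "t \<in> einterval T.lo T.hi" for t
    using y(1)[OF u01[OF that]] d_pos[OF u01[OF that]] by (simp add: u'_def)
  have u_cont: "continuous_on (einterval T.lo T.hi) u" using du by (rule DERIV_imp_continuous_on)
  have cont_comp: "continuous_on (einterval T.lo T.hi) (\<lambda>t. F (u t))"
    if "continuous_on {0<..<1} F" for F :: "real \<Rightarrow> real"
    by (rule continuous_on_compose2[OF that u_cont]) (use u01 in auto)
  have u'_cont: "continuous_on (einterval T.lo T.hi) u'"
  proof -
    have "continuous_on {0<..<1} (\<lambda>v. - ((y v / d v) powr q))"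
      using y(1) d_pos
      by (intro continuous_intros d_cont y_cont) (force simp: less_imp_neq[symmetric])+
    from cont_comp[OF this] show ?thesis by (simp add: u'_def[abs_def])
  qed
  have flux_eq: "flux p d u t = - y (u t)" if t: "t \<in> einterval T.lo T.hi" for t
  proof -
    have "deriv u t = u' t" by (rule DERIV_imp_deriv[OF du[OF t]])
    moreover have "(- u' t) powr (p - 1) = y (u t) / d (u t)"
      using y(1)[OF u01[OF t]] d_pos[OF u01[OF t]] p by (simp add: u'_def powr_powr q_def)
    ultimately show ?thesis
      using neg_flux_eq[OF u'_neg[OF t], of p] d_pos[OF u01[OF t]]
      by (simp add: flux_def mult.assoc)
  qed
  define y' where "y' v = h c v - R v * y v powr - q" for v
  have dflux: "(flux p d u has_real_derivative - (y' (u t) * u' t)) (at t)"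
    if t: "t \<in> einterval T.lo T.hi" for t
  proof -
    have "((\<lambda>t. - y (u t)) has_real_derivative - (y' (u t) * u' t)) (at t)"
      unfolding y'_def by (intro DERIV_minus DERIV_chain2[OF y(2) du[OF t]] u01[OF t])
    then show ?thesis
      by (rule has_field_derivative_transform_within_open[OF _ _ t]) (use flux_eq in auto)
  qed
  have y'_cont: "continuous_on {0<..<1} y'"
    unfolding y'_def[abs_def] using y(1)
    by (intro continuous_intros R_cont y_cont continuous_on_subset[OF h])
      (force simp: less_imp_neq[symmetric])+
  have u_left: "filterlim (\<lambda>x. ereal (u (real_of_ereal x))) (at_left (ereal 1)) (at_right T.lo)"
    using T.filterlim_g_at_right by (simp add: u_def one_ereal_def)
  have u_right: "filterlim (\<lambda>x. ereal (u (real_of_ereal x))) (at_right (ereal 0)) (at_left T.hi)"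
    using T.filterlim_g_at_left by (simp add: u_def zero_ereal_def)
  have "travelling_wave p f g \<rho> d c T.lo T.hi u"
    unfolding travelling_wave_def
  proof (intro conjI ballI)
    show "T.lo < T.hi" by (rule T.lo_less_hi)
    show "u C1_differentiable_on einterval T.lo T.hi"
      using du u'_cont by (rule C1_differentiable_onI)
    show "flux p d u C1_differentiable_on einterval T.lo T.hi"
      by (rule C1_differentiable_onI[OF dflux])
        (auto intro!: continuous_intros cont_comp y'_cont u'_cont)
    fix t assume t: "t \<in> einterval T.lo T.hi"
    show "0 < u t" "u t < 1" using u01[OF t] .
    have "\<rho> (u t) = - (R (u t) * y (u t) powr - q * u' t)"
      using y(1)[OF u01[OF t]] d_pos[OF u01[OF t]]
      by (simp add: R_def u'_def powr_divide powr_minus field_simps)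
    then show "deriv (flux p d u) t + (c * g (u t) - f (u t)) * deriv u t + \<rho> (u t) = 0"
      using DERIV_imp_deriv[OF du[OF t]] DERIV_imp_deriv[OF dflux[OF t]]
      by (simp add: y'_def h_def algebra_simps)
  next
    have "((\<lambda>x. ereal (u (real_of_ereal x))) \<longlongrightarrow> ereal 1) (at_right T.lo)"
      using u_left by (rule filterlim_mono) (auto simp: at_within_le_nhds)
    then show "((u \<circ> real_of_ereal) \<longlongrightarrow> 1) (at_right T.lo)" by (simp add: comp_def)
    have "((\<lambda>x. ereal (u (real_of_ereal x))) \<longlongrightarrow> ereal 0) (at_left T.hi)"
      using u_right by (rule filterlim_mono) (auto simp: at_within_le_nhds)
    then show "((u \<circ> real_of_ereal) \<longlongrightarrow> 0) (at_left T.hi)" by (simp add: comp_def)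
    have "((y \<circ> real_of_ereal) \<longlongrightarrow> 0) (at_left (ereal 1))"
      using y(4) by (simp only: ereal_tendsto_simps1)
    from tendsto_minus[OF filterlim_compose[OF this u_left]]
    have 1: "((\<lambda>x. - y (u (real_of_ereal x))) \<longlongrightarrow> 0) (at_right T.lo)" by simp
    show "((flux p d u \<circ> real_of_ereal) \<longlongrightarrow> 0) (at_right T.lo)"
    proof (rule Lim_transform_eventually[OF 1])
      show "\<forall>\<^sub>F x in at_right T.lo. - y (u (real_of_ereal x)) = (flux p d u \<circ> real_of_ereal) x"
        using eventually_einterval_at_right[OF T.lo_less_hi]
        by eventually_elim (simp add: flux_eq)
    qed
    have "((y \<circ> real_of_ereal) \<longlongrightarrow> 0) (at_right (ereal 0))"
      using y(3) by (simp only: ereal_tendsto_simps1)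
    from tendsto_minus[OF filterlim_compose[OF this u_right]]
    have 2: "((\<lambda>x. - y (u (real_of_ereal x))) \<longlongrightarrow> 0) (at_left T.hi)" by simp
    show "((flux p d u \<circ> real_of_ereal) \<longlongrightarrow> 0) (at_left T.hi)"
    proof (rule Lim_transform_eventually[OF 2])
      show "\<forall>\<^sub>F x in at_left T.hi. - y (u (real_of_ereal x)) = (flux p d u \<circ> real_of_ereal) x"
        using eventually_einterval_at_left[OF T.lo_less_hi]
        by eventually_elim (simp add: flux_eq)
    qed
  qed
  then show ?thesis by blast
qed

end

subsection \<open>The threshold speed\<close>

context standing
begin

lemma profile_at_0: "profile q (h c) R y \<Longrightarrow> profile_at_0 q (h c) R y"
  by unfold_locales (use q h R_pos in auto)

lemma powr_gap: "0 < a \<Longrightarrow> a \<le> b \<Longrightarrow> 0 < v \<Longrightarrow> v < 1 \<Longrightarrow> R v * b powr - q \<le> R v * a powr - q"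
  using R_pos[of v] q by (intro mult_left_mono powr_mono2') auto

lemma slope_zero_above:
  assumes prof: "profile q (h c) R y" and prof0: "profile q (h c0) R y0" and c: "c0 < c"
    and lim: "((\<lambda>v. R v * v powr - q) \<longlongrightarrow> 0) (at_right 0)"
  shows "((\<lambda>v. y v / v) \<longlongrightarrow> 0) (at_right 0)"
proof (rule ccontr)
  assume contra: "\<not> ?thesis"
  interpret Y: profile_at_0 q "h c" R y by (rule profile_at_0[OF prof])
  interpret Y0: profile_at_0 q "h c0" R y0 by (rule profile_at_0[OF prof0])
  have slope: "((\<lambda>v. y v / v) \<longlongrightarrow> h c 0) (at_right 0)"
    using Y.slope_dichotomy[OF lim] contra by blast
  have "c0 * g 0 < c * g 0" using c g0 by simp
  then have "h c0 0 < h c 0" by (simp add: h_def)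
  \<comment> \<open>\<open>m\<close> separates the two growth rates at \<open>0\<close>: near
    \<open>0\<close>, \<open>y0 v \<le> m * v < y v\<close>.\<close>
  then obtain m where m: "h c0 0 < m" "m < h c 0" using dense by blast
  define G where "G v = (c - c0) * integral {0..v} g" for v
  define k where "k v = y v - y0 v" for v
  define k' where "k' v = (h c v - R v * y v powr - q) - (h c0 v - R v * y0 v powr - q)" for v
  have dk: "(k has_real_derivative k' v) (at v)" if "0 < v" "v < 1" for v
    unfolding k_def k'_def by (intro DERIV_diff Y.y(2) Y0.y(2) that)
  have dG: "(G has_real_derivative (c - c0) * g v) (at v)" if v: "0 < v" "v < 1" for v
  proof -
    have "((\<lambda>v. integral {0..v} g) has_real_derivative g v) (at v within {0..1})"
      using v by (intro integral_has_real_derivative g) auto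
    then have "((\<lambda>v. integral {0..v} g) has_real_derivative g v) (at v)"
      using v by (simp add: at_within_Icc_at)
    then show ?thesis unfolding G_def by (rule DERIV_cmult)
  qed
  have k'_ge: "(c - c0) * g v \<le> k' v" if v: "0 < v" "v < 1" "0 < k v" for v
    using powr_gap[of "y0 v" "y v" v] Y0.y(1)[of v] v
    by (simp add: k_def k'_def h_def algebra_simps)
  have G_cont: "continuous_on {0..1} G"
    unfolding G_def by (intro continuous_intros indefinite_integral_continuous_1
      integrable_continuous_real g)
  have "\<forall>\<^sub>F v in at_right 0. 0 < k v"
    using order_tendstoD(1)[OF slope m(2)] Y0.y_le[OF m(1)] Y.ev01
  proof eventually_elim
    case (elim v)
    then have "m * v < y v" by (simp add: pos_less_divide_eq)
    then show ?case using elim(2) by (simp add: k_def)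
  qed
  then obtain b where b: "0 < b" "b < 1" "\<And>v. 0 < v \<Longrightarrow> v \<le> b \<Longrightarrow> 0 < k v"
    using eventually_at_right_0_obtain by blast
  \<comment> \<open>\<open>g\<close> may change sign, and only its integrals from \<open>0\<close>
    are known to be positive. The comparison must therefore begin at \<open>0\<close> itself, where
    both sides vanish; \<open>G b \<le> k b\<close> then makes \<open>k b + G x - G b\<close> at
    least \<open>G x > 0\<close>, as the continuation to \<open>1\<close> requires.\<close>
  have G_le: "G b - k b \<le> 0 * b"
  proof (rule le_mult_of_deriv_le)
    have "(G \<longlongrightarrow> 0) (at_right 0)"
      using continuous_on_Icc_at_rightD[OF G_cont] by (simp add: G_def)
    then show "((\<lambda>v. G v - k v) \<longlongrightarrow> 0) (at_right 0)"
      unfolding k_def using tendsto_diff[OF _ tendsto_diff[OF Y.y(3) Y0.y(3)]] by fastforce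
    fix x assume x: "0 < x" "x \<le> b"
    show "((\<lambda>v. G v - k v) has_real_derivative (c - c0) * g x - k' x) (at x)"
      using x b by (intro DERIV_diff dG dk) auto
    show "(c - c0) * g x - k' x \<le> 0" using k'_ge[of x] b x by auto
  qed (use b in auto)
  have G_pos: "0 < G v" if "0 < v" "v \<le> 1" for v
    using int_g[OF that] c by (simp add: G_def)
  have k_ge: "G v \<le> k v" if v: "b \<le> v" "v < 1" for v
  proof -
    have "k b + G v - G b \<le> k v"
    proof (rule growth_bound_while_positive[where b = 1 and k' = k' and P' = "\<lambda>v. (c - c0) * g v"])
      show "0 < k b + G x - G b" if "b \<le> x" "x < 1" for x
        using G_pos[of x] G_le that b by auto
    qed (use dk dG k'_ge b v in auto)
    then show ?thesis using G_le by simp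
  qed
  have "(k \<longlongrightarrow> 0) (at_left 1)"
    unfolding k_def using tendsto_diff[OF Y.y(4) Y0.y(4)] by simp
  moreover have "(G \<longlongrightarrow> G 1) (at_left 1)"
    using continuous_on_Icc_at_leftD[OF G_cont] by simp
  moreover have "\<forall>\<^sub>F v in at_left 1. G v \<le> k v"
    using eventually_at_left_real[OF b(2)] by eventually_elim (use k_ge in auto)
  ultimately have "G 1 \<le> 0" by (intro tendsto_le[of "at_left 1" k _ G]) auto
  then show False using G_pos[of 1] by simp
qed

text \<open>The backward solution \<open>y\<close> from \<open>v = 1\<close> for a slightly smaller speed stays close to \<open>y0\<close>, hence
  starts below the line \<open>\<mu> * v\<close> at \<open>b\<close> and is trapped below it down to \<open>v = 0\<close>.\<close>

lemma slower_wave: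
  assumes prof0: "profile q (h c0) R y0" and h0: "0 < h c0 0"
    and slope: "((\<lambda>v. y0 v / v) \<longlongrightarrow> 0) (at_right 0)"
    and lim: "((\<lambda>v. R v * v powr - q) \<longlongrightarrow> 0) (at_right 0)"
  shows "\<exists>c<c0. \<exists>\<alpha> \<beta> u. travelling_wave p f g \<rho> d c \<alpha> \<beta> u"
proof -
  interpret Y0: profile_at_0 q "h c0" R y0 by (rule profile_at_0[OF prof0])
  obtain G where "\<And>v. v \<in> {0..1} \<Longrightarrow> \<bar>g v\<bar> \<le> G"
    using continuous_on_Icc_bounded[OF g] by blast
  then have G: "\<And>v. 0 \<le> v \<Longrightarrow> v \<le> 1 \<Longrightarrow> \<bar>g v\<bar> \<le> G" by simp
  from G[of 0] g0 have G0: "0 < G" by simp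
  \<comment> \<open>Any slope strictly between \<open>0\<close> and \<open>h c0 0\<close> would
    serve as a barrier.\<close>
  define \<mu> where "\<mu> = h c0 0 / 2"
  have \<mu>: "0 < \<mu>" using h0 by (simp add: \<mu>_def)
  have "((\<lambda>v. h c0 v - R v * (\<mu> * v) powr - q) \<longlongrightarrow> h c0 0 - 0) (at_right 0)"
    by (intro tendsto_diff Y0.h_tendsto Y0.scaled_limit[OF \<mu> lim])
  \<comment> \<open>\<open>3/2 * \<mu>\<close> lies midway between the slope \<open>\<mu>\<close> of
    the line and the limit \<open>h c0 0 = 2 * \<mu>\<close>. The margin \<open>\<mu> / 2\<close>
    pays for the reduction of the speed.\<close>
  then have "\<forall>\<^sub>F v in at_right 0. 3/2 * \<mu> < h c0 v - R v * (\<mu> * v) powr - q"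
    using h0 by (intro order_tendstoD(1)) (auto simp: \<mu>_def)
  moreover have "\<forall>\<^sub>F v in at_right 0. y0 v / v < \<mu>"
    using order_tendstoD(2)[OF slope \<mu>] .
  ultimately have "\<forall>\<^sub>F v in at_right 0. 3/2 * \<mu> < h c0 v - R v * (\<mu> * v) powr - q \<and> y0 v < \<mu> * v"
    using Y0.ev01 by eventually_elim (auto simp: pos_divide_less_eq)
  then obtain b where b: "0 < b" "b < 1"
    and b': "\<And>v. 0 < v \<Longrightarrow> v \<le> b \<Longrightarrow> 3/2 * \<mu> < h c0 v - R v * (\<mu> * v) powr - q \<and> y0 v < \<mu> * v"
    by (rule eventually_at_right_0_obtain) blast
  \<comment> \<open>\<open>\<delta> * G\<close> bounds how much \<open>h\<close> can drop. Half of
    the gap at \<open>b\<close> keeps \<open>y\<close> below the line there;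
    \<open>\<mu> / 2\<close> keeps the line an upward-crossing barrier for the new speed.\<close>
  define \<delta> where "\<delta> = min ((\<mu> * b - y0 b) / 2) (\<mu> / 2) / G"
  have gap: "0 < \<mu> * b - y0 b" using b'[of b] b by simp
  have "\<delta> * G = min ((\<mu> * b - y0 b) / 2) (\<mu> / 2)" using G0 by (simp add: \<delta>_def)
  moreover have "0 < \<delta>" using gap \<mu> G0 by (simp add: \<delta>_def)
  ultimately have \<delta>: "0 < \<delta>" "\<delta> * G < \<mu> * b - y0 b" "\<delta> * G \<le> \<mu> / 2"
    using gap by (auto simp: min_less_iff_disj)
  define c where "c = c0 - \<delta>"
  have h_c: "h c v = h c0 v - \<delta> * g v" for v by (simp add: h_def c_def algebra_simps)
  have \<delta>g: "\<delta> * g v \<le> \<delta> * G" if "0 \<le> v" "v \<le> 1" for v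
    using G[OF that] \<delta>(1) by (intro mult_left_mono) auto
  obtain y where y: "\<And>v. 0 < v \<Longrightarrow> v < 1 \<Longrightarrow> 0 < y v"
    "\<And>v. 0 < v \<Longrightarrow> v < 1 \<Longrightarrow> (y has_real_derivative h c v - R v * y v powr - q) (at v)"
    "(y \<longlongrightarrow> 0) (at_left 1)"
    using profile_from_1[OF q h R_integrable R_cont R_pos] by blast
  \<comment> \<open>An excess of \<open>y\<close> over \<open>y0\<close> above
    \<open>\<delta> * G\<close> at \<open>b\<close> loses at most \<open>\<delta> * G\<close> on the
    way to \<open>1\<close>, so some of it would survive, although both functions tend to
    \<open>0\<close> there.\<close>
  have "y b \<le> y0 b + \<delta> * G"
  proof (rule ccontr)
    assume "\<not> y b \<le> y0 b + \<delta> * G"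
    then have kb: "\<delta> * G < y b - y0 b" by simp
    have drop: "\<delta> * G * (v - b) \<le> \<delta> * G" if "b \<le> v" "v < 1" for v
      using that b \<delta>(1) G0 by (intro mult_left_le) auto
    have "y b - y0 b + - (\<delta> * G) * v - - (\<delta> * G) * b \<le> y v - y0 v" if v: "b \<le> v" "v < 1" for v
    proof (rule growth_bound_while_positive[where b = 1 and a = b and P = "\<lambda>v. - (\<delta> * G) * v"
          and k = "\<lambda>v. y v - y0 v" and P' = "\<lambda>_. - (\<delta> * G)"
          and k' = "\<lambda>v. (h c v - R v * y v powr - q) - (h c0 v - R v * y0 v powr - q)"])
      fix x assume x: "b \<le> x" "x < 1"
      show "((\<lambda>v. y v - y0 v) has_real_derivative
          (h c x - R x * y x powr - q) - (h c0 x - R x * y0 x powr - q)) (at x)"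
        using x b by (intro DERIV_diff y Y0.y) auto
      show "((\<lambda>v. - (\<delta> * G) * v) has_real_derivative - (\<delta> * G)) (at x)"
        by (auto intro!: derivative_eq_intros)
      show "0 < y b - y0 b + - (\<delta> * G) * x - - (\<delta> * G) * b"
        using drop[OF x] kb by (simp add: algebra_simps)
      show "- (\<delta> * G) \<le> (h c x - R x * y x powr - q) - (h c0 x - R x * y0 x powr - q)"
        if "0 < y x - y0 x"
        using powr_gap[of "y0 x" "y x" x] Y0.y(1)[of x] \<delta>g[of x] x b that by (simp add: h_c)
    qed (use v in auto)
    then have "y b - y0 b - \<delta> * G \<le> y v - y0 v" if "b \<le> v" "v < 1" for v
      using drop[OF that] that by (fastforce simp: algebra_simps)
    then have "\<forall>\<^sub>F v in at_left 1. y b - y0 b - \<delta> * G \<le> y v - y0 v"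
      using eventually_at_left_real[OF b(2)] by (auto elim!: eventually_mono)
    from tendsto_lowerbound[OF tendsto_diff[OF y(3) Y0.y(4)] this] show False using kb by simp
  qed
  then have yb: "y b - \<mu> * b < 0" using \<delta>(2) by simp
  have below: "y v < \<mu> * v" if v: "0 < v" "v < b" for v
  proof -
    have "y v - \<mu> * v < 0"
    proof (rule negative_left_of_upcrossing[where b = b and k = "\<lambda>v. y v - \<mu> * v"
          and k' = "\<lambda>v. h c v - R v * y v powr - q - \<mu>"])
      show "((\<lambda>v. y v - \<mu> * v) has_real_derivative h c x - R x * y x powr - q - \<mu>) (at x)"
        if "0 < x" "x \<le> b" for x
        using y(2)[of x] that b by (auto intro!: derivative_eq_intros)
      show "0 < h c x - R x * y x powr - q - \<mu>" if x: "0 < x" "x < b" and "y x - \<mu> * x = 0" for x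
      proof -
        have "y x = \<mu> * x" using that by simp
        then show ?thesis using b'[of x] \<delta>g[of x] \<delta>(3) x b by (simp add: h_c)
      qed
    qed (use yb v in auto)
    then show ?thesis by simp
  qed
  have "(y \<longlongrightarrow> 0) (at_right 0)"
  proof (rule tendsto_sandwich[OF _ _ tendsto_const])
    show "((\<lambda>v. \<mu> * v) \<longlongrightarrow> 0) (at_right 0)"
      using tendsto_mult[OF tendsto_const[of \<mu>] tendsto_ident_at[of 0 "{0<..}"]] by simp
    show "\<forall>\<^sub>F v in at_right 0. 0 \<le> y v"
      using Y0.ev01 by eventually_elim (use y(1) in \<open>auto simp: less_imp_le\<close>)
    show "\<forall>\<^sub>F v in at_right 0. y v \<le> \<mu> * v"
      using eventually_at_right_0_less[OF b(1)] by eventually_elim (use below in \<open>auto simp: less_imp_le\<close>)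
  qed
  then have "profile q (h c) R y" using y by (auto simp: profile_def)
  from profile_wave[OF this] show ?thesis using \<delta>(1) by (intro exI[of _ c]) (simp add: c_def)
qed

end

locale wave_profile_threshold = standing +
  fixes cstar c :: real and y :: "real \<Rightarrow> real"
  assumes thr: "threshold_speed p f g \<rho> d cstar" and c: "cstar \<le> c"
    and prof: "profile q (h c) R y"
begin

sublocale profile_at_0 q "h c" R y by (rule profile_at_0[OF prof])

text \<open>The threshold is used in both directions. At \<open>cstar\<close>, slope
  \<open>0\<close> together with \<open>h c 0 > 0\<close> would produce a wave of smaller speed.
  Above \<open>cstar\<close>, the existence of a wave at \<open>cstar\<close> itself supplies the
  lower profile for \<open>slope_zero_above\<close>.\<close>

lemma slope_limit:
  assumes lim: "((\<lambda>v. R v * v powr - q) \<longlongrightarrow> 0) (at_right 0)"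
  shows "((\<lambda>v. y v / v) \<longlongrightarrow> (if c = cstar then h c 0 else 0)) (at_right 0)"
proof (cases "c = cstar")
  case True
  show ?thesis
  proof (rule ccontr)
    assume contra: "\<not> ?thesis"
    then have slope: "((\<lambda>v. y v / v) \<longlongrightarrow> 0) (at_right 0)" "h c 0 \<noteq> 0"
      using slope_dichotomy[OF lim] True by auto
    then obtain c' \<alpha> \<beta> u where "c' < c" "travelling_wave p f g \<rho> d c' \<alpha> \<beta> u"
      using slower_wave[OF prof _ _ lim] h0_nonneg by fastforce
    then have "cstar \<le> c'" using thr unfolding threshold_speed_def by blast
    then show False using True \<open>c' < c\<close> by simp
  qed
next
  case False
  obtain \<alpha> \<beta> u where "travelling_wave p f g \<rho> d cstar \<alpha> \<beta> u"
    using thr unfolding threshold_speed_def by blast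
  then obtain y0 where "profile q (h cstar) R y0" by (rule wave_profile)
  then show ?thesis using slope_zero_above[OF prof _ _ lim] False c by auto
qed

end

lemma filterlim_powr_at_top:
  fixes q :: real
  assumes "0 < q" and f: "filterlim f at_top F"
  shows "filterlim (\<lambda>x. f x powr q) at_top F"
  unfolding filterlim_at_top_dense
proof
  fix Z :: real
  have "\<forall>\<^sub>F x in F. max 1 (\<bar>Z\<bar> powr (1 / q)) < f x"
    using f unfolding filterlim_at_top_dense by blast
  then show "\<forall>\<^sub>F x in F. Z < f x powr q"
  proof eventually_elim
    case (elim x)
    have "Z \<le> (\<bar>Z\<bar> powr (1 / q)) powr q" using \<open>0 < q\<close> by (simp add: powr_powr)
    also have "\<dots> < f x powr q" using elim \<open>0 < q\<close> by (intro powr_less_mono2) auto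
    finally show ?case .
  qed
qed

section \<open>The limit of the derivative in the four cases\<close>

context wave_profile_threshold
begin

context
  fixes u :: "real \<Rightarrow> real" and \<alpha> \<beta> :: ereal
  assumes ne: "\<alpha> < \<beta>"
    and u': "\<And>t. t \<in> einterval \<alpha> \<beta> \<Longrightarrow> deriv u t = - ((y (u t) / d (u t)) powr q)"
    and u_lim: "filterlim (\<lambda>x. u (real_of_ereal x)) (at_right 0) (at_left \<beta>)"
begin

lemma deriv_filterlim:
  assumes "filterlim (\<lambda>v. - ((y v / d v) powr q)) F (at_right 0)"
  shows "filterlim (deriv u \<circ> real_of_ereal) F (at_left \<beta>)"
proof -
  have "\<forall>\<^sub>F x in at_left \<beta>. - ((y (u (real_of_ereal x)) / d (u (real_of_ereal x))) powr q)
      = (deriv u \<circ> real_of_ereal) x"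
    using eventually_einterval_at_left[OF ne] by eventually_elim (simp add: u')
  from filterlim_cong[OF refl refl this, THEN iffD1, OF filterlim_compose[OF assms u_lim]]
  show ?thesis .
qed

lemma ratio_nonneg: "\<forall>\<^sub>F v in at_right 0. 0 \<le> y v / d v"
  using ev01 by eventually_elim (use y(1) d_pos in \<open>auto simp: less_imp_le\<close>)

lemma deriv_tendsto:
  assumes "((\<lambda>v. y v / d v) \<longlongrightarrow> L) (at_right 0)"
  shows "((deriv u \<circ> real_of_ereal) \<longlongrightarrow> - (L powr q)) (at_left \<beta>)"
  by (intro deriv_filterlim tendsto_minus tendsto_powr2[OF assms tendsto_const ratio_nonneg] q)

lemma deriv_tendsto_0:
  assumes "((\<lambda>v. y v / d v) \<longlongrightarrow> 0) (at_right 0)"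
  shows "((deriv u \<circ> real_of_ereal) \<longlongrightarrow> 0) (at_left \<beta>)"
  using deriv_tendsto[OF assms] by simp

text \<open>\<open>d\<close> stays away from \<open>0\<close> while \<open>y\<close> tends to
  \<open>0\<close>, so the boundary value of the profile decides.\<close>

lemma case_nondegenerate:
  assumes "0 < Liminf (at_right 0) (\<lambda>v. ereal (d v))"
  shows "((deriv u \<circ> real_of_ereal) \<longlongrightarrow> 0) (at_left \<beta>)"
proof (rule deriv_tendsto_0)
  obtain e where e: "0 < e" "ereal e < Liminf (at_right 0) (\<lambda>v. ereal (d v))"
    using ereal_dense2[OF assms] by auto
  show "((\<lambda>v. y v / d v) \<longlongrightarrow> 0) (at_right 0)"
  proof (rule tendsto_sandwich[OF ratio_nonneg _ tendsto_const])
    show "((\<lambda>v. y v / e) \<longlongrightarrow> 0) (at_right 0)"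
      using tendsto_divide[OF y(3) tendsto_const[of e]] e(1) by simp
    show "\<forall>\<^sub>F v in at_right 0. y v / d v \<le> y v / e"
      using less_LiminfD[OF e(2)] ev01
      by eventually_elim (use e(1) y(1) in \<open>auto intro!: divide_left_mono simp: less_imp_le\<close>)
  qed
qed

lemma ratio_eq: "\<forall>\<^sub>F v in at_right 0. (y v / v) / (d v / v) = y v / d v"
  using ev01 by eventually_elim auto

text \<open>The dichotomy is out of reach, since \<open>\<rho> v * (d v / v) powr q\<close> is now
  an indeterminate product; the linear upper bound for \<open>y\<close> is enough, because
  \<open>d\<close> outgrows every multiple of \<open>v\<close>.\<close>

lemma case_infinite_slope:
  assumes "filterlim (\<lambda>v. d v / v) at_top (at_right 0)"
  shows "((deriv u \<circ> real_of_ereal) \<longlongrightarrow> 0) (at_left \<beta>)"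
proof (rule deriv_tendsto_0)
  obtain B where B: "h c 0 < B" using gt_ex by blast
  show "((\<lambda>v. y v / d v) \<longlongrightarrow> 0) (at_right 0)"
  proof (rule tendsto_sandwich[OF ratio_nonneg _ tendsto_const])
    show "((\<lambda>v. B / (d v / v)) \<longlongrightarrow> 0) (at_right 0)"
      by (rule real_tendsto_divide_at_top[OF tendsto_const assms])
    show "\<forall>\<^sub>F v in at_right 0. y v / d v \<le> B / (d v / v)"
      using slope_le[OF B] ratio_eq ev01
    proof eventually_elim
      case (elim v)
      then have "(y v / v) / (d v / v) \<le> B / (d v / v)"
        using d_pos[of v] by (intro divide_right_mono) auto
      then show ?case using elim by simp
    qed
  qed
qed

lemma R_limit:
  assumes "((\<lambda>v. d v / v) \<longlongrightarrow> d0) (at_right 0)"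
  shows "((\<lambda>v. R v * v powr - q) \<longlongrightarrow> 0) (at_right 0)"
proof -
  have "(\<rho> \<longlongrightarrow> 0) (at_right 0)"
    using continuous_on_Icc_at_rightD[OF \<rho>] \<rho>0 by simp
  moreover have "((\<lambda>v. (d v / v) powr q) \<longlongrightarrow> d0 powr q) (at_right 0)"
  proof (rule tendsto_powr2[OF assms tendsto_const _ q])
    show "\<forall>\<^sub>F v in at_right 0. 0 \<le> d v / v"
      using ev01 by eventually_elim (use d_pos in \<open>auto simp: less_imp_le\<close>)
  qed
  ultimately have "((\<lambda>v. \<rho> v * (d v / v) powr q) \<longlongrightarrow> 0 * d0 powr q) (at_right 0)"
    by (rule tendsto_mult)
  then have "((\<lambda>v. \<rho> v * (d v / v) powr q) \<longlongrightarrow> 0) (at_right 0)" by simp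
  then show ?thesis
  proof (rule Lim_transform_eventually)
    show "\<forall>\<^sub>F v in at_right 0. \<rho> v * (d v / v) powr q = R v * v powr - q"
      using ev01
    proof eventually_elim
      case (elim v)
      then show ?case using d_pos[of v] by (simp add: R_def powr_divide powr_minus_divide)
    qed
  qed
qed

lemma case_finite_slope:
  assumes lim: "((\<lambda>v. d v / v) \<longlongrightarrow> d0) (at_right 0)" and d0: "0 < d0"
  shows "((deriv u \<circ> real_of_ereal) \<longlongrightarrow> (if c = cstar then - ((h cstar 0 / d0) powr q) else 0)) (at_left \<beta>)"
proof -
  have "((\<lambda>v. (y v / v) / (d v / v)) \<longlongrightarrow> (if c = cstar then h c 0 else 0) / d0) (at_right 0)"
    using d0 by (intro tendsto_divide slope_limit R_limit[OF lim] lim) auto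
  from deriv_tendsto[OF Lim_transform_eventually[OF this ratio_eq]] show ?thesis
    by (auto split: if_splits)
qed

text \<open>By l'Hopital's rule \<open>d v / v\<close> tends to \<open>0\<close>. For
  \<open>c = cstar\<close> the quotient \<open>(y v / v) / (d v / v)\<close> has a positive limit in
  the numerator and blows up; for \<open>cstar < c\<close> it is of the form \<open>0 / 0\<close>,
  and the finer barrier argument of \<open>ratio_tendsto_0\<close> decides.\<close>

lemma case_zero_slope:
  assumes lim: "(d \<longlongrightarrow> 0) (at_right 0)" and lim': "(deriv d \<longlongrightarrow> 0) (at_right 0)"
    and h0: "h c 0 \<noteq> 0"
  shows "c = cstar \<Longrightarrow> filterlim (deriv u \<circ> real_of_ereal) at_bot (at_left \<beta>)"
    and "cstar < c \<Longrightarrow> ((deriv u \<circ> real_of_ereal) \<longlongrightarrow> 0) (at_left \<beta>)"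
proof -
  have h0': "0 < h c 0" using h0_nonneg h0 by simp
  have dv: "((\<lambda>v. d v / v) \<longlongrightarrow> 0) (at_right 0)"
  proof (rule lhopital_right_0[where g' = "\<lambda>_. 1"])
    show "\<forall>\<^sub>F v in at_right 0. (d has_real_derivative deriv d v) (at v)"
      using ev01 by eventually_elim (use d_deriv in auto)
    show "\<forall>\<^sub>F v in at_right (0::real). v \<noteq> 0" using ev01 by eventually_elim auto
    show "((\<lambda>v. deriv d v / 1) \<longlongrightarrow> 0) (at_right 0)" using lim' by simp
  qed (use lim in \<open>auto intro: tendsto_ident_at\<close>)
  note slope = slope_limit[OF R_limit[OF dv]]
  show "filterlim (deriv u \<circ> real_of_ereal) at_bot (at_left \<beta>)" if "c = cstar"
  proof (rule deriv_filterlim)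
    have inv: "filterlim (\<lambda>v. inverse (d v / v)) at_top (at_right 0)"
    proof (rule filterlim_inverse_at_top[OF dv])
      show "\<forall>\<^sub>F v in at_right 0. 0 < d v / v"
        using ev01 by eventually_elim (use d_pos in auto)
    qed
    have "((\<lambda>v. y v / v) \<longlongrightarrow> h c 0) (at_right 0)" using slope that by simp
    from filterlim_tendsto_pos_mult_at_top[OF this h0' inv]
    have "filterlim (\<lambda>v. (y v / v) / (d v / v)) at_top (at_right 0)"
      by (simp only: divide_inverse)
    from filterlim_cong[OF refl refl ratio_eq, THEN iffD1, OF this]
    have "filterlim (\<lambda>v. y v / d v) at_top (at_right 0)" .
    from filterlim_powr_at_top[OF q this]
    show "filterlim (\<lambda>v. - ((y v / d v) powr q)) at_bot (at_right 0)"
      by (simp add: filterlim_uminus_at_top)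
  qed
  show "((deriv u \<circ> real_of_ereal) \<longlongrightarrow> 0) (at_left \<beta>)" if "cstar < c"
  proof (rule deriv_tendsto_0, rule ratio_tendsto_0[OF _ lim' _ h0'])
    show "(d has_real_derivative deriv d v) (at v) \<and> 0 < d v" if "0 < v" "v < 1" for v
      using that d_deriv d_pos by blast
    show "((\<lambda>v. y v / v) \<longlongrightarrow> 0) (at_right 0)" using slope that by simp
    have "(\<rho> \<longlongrightarrow> 0) (at_right 0)"
      using continuous_on_Icc_at_rightD[OF \<rho>] \<rho>0 by simp
    \<comment> \<open>The singular term along \<open>d\<close> is exactly
      \<open>\<rho>\<close>.\<close>
    then show "((\<lambda>v. R v * d v powr - q) \<longlongrightarrow> 0) (at_right 0)"
    proof (rule Lim_transform_eventually)
      show "\<forall>\<^sub>F v in at_right 0. \<rho> v = R v * d v powr - q"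
        using ev01
      proof eventually_elim
        case (elim v)
        then show ?case using d_pos[of v] by (simp add: R_def powr_minus)
      qed
    qed
  qed
qed

end

end

theorem theorem15:
  fixes p c cstar l0 :: real
    and f g \<rho> d u :: "real \<Rightarrow> real"
    and \<alpha> \<beta> :: ereal
  assumes "standing_assumptions p f g \<rho> d"
    and "((\<lambda>v. \<rho> v * (d v / v) powr (1 / (p - 1))) \<longlongrightarrow> l0) (at_right 0)"
    and "threshold_speed p f g \<rho> d cstar"
    and "cstar \<le> c"
    and "travelling_wave p f g \<rho> d c \<alpha> \<beta> u"
  shows
    "(Liminf (at_right 0) (\<lambda>v. ereal (d v)) > 0 \<longrightarrow>
        ((deriv u \<circ> real_of_ereal) \<longlongrightarrow> 0) (at_left \<beta>)) \<and>
     ((d \<longlongrightarrow> 0) (at_right 0) \<and> filterlim (\<lambda>v. d v / v) at_top (at_right 0) \<longrightarrow>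
        ((deriv u \<circ> real_of_ereal) \<longlongrightarrow> 0) (at_left \<beta>)) \<and>
     (\<forall>d0::real. (d \<longlongrightarrow> 0) (at_right 0) \<and> ((\<lambda>v. d v / v) \<longlongrightarrow> d0) (at_right 0) \<and> 0 < d0 \<longrightarrow>
        ((deriv u \<circ> real_of_ereal) \<longlongrightarrow>
           (if c = cstar then - (((cstar * g 0 - f 0) / d0) powr (1 / (p - 1))) else 0))
          (at_left \<beta>)) \<and>
     ((d \<longlongrightarrow> 0) (at_right 0) \<and> (deriv d \<longlongrightarrow> 0) (at_right 0) \<and> c * g 0 - f 0 \<noteq> 0 \<longrightarrow>
        (c = cstar \<longrightarrow> filterlim (deriv u \<circ> real_of_ereal) at_bot (at_left \<beta>)) \<and>
        (c > cstar \<longrightarrow> ((deriv u \<circ> real_of_ereal) \<longlongrightarrow> 0) (at_left \<beta>)))"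
proof -
  interpret standing p f g \<rho> d by unfold_locales (rule assms(1))
  obtain y where prof: "profile q (h c) R y"
    and u': "\<And>t. t \<in> einterval \<alpha> \<beta> \<Longrightarrow> deriv u t = - ((y (u t) / d (u t)) powr q)"
    and u_lim: "filterlim (\<lambda>x. u (real_of_ereal x)) (at_right 0) (at_left \<beta>)"
    by (rule wave_profile[OF assms(5)]) blast
  interpret wave_profile_threshold p f g \<rho> d cstar c y
    by unfold_locales (use assms prof in auto)
  note ne = wave_ne[OF assms(5)]
  note cases = case_nondegenerate[OF ne u' u_lim] case_infinite_slope[OF ne u' u_lim]
    case_finite_slope[OF ne u' u_lim, unfolded h_def q_def]
    case_zero_slope[OF ne u' u_lim, unfolded h_def]
  show ?thesis
    by (intro conjI allI impI; (elim conjE)?; rule cases; assumption)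
qed

end
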